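(* For each $n\in\mathbb{N}\cup\{\infty\}$ (where $\mathbb{N}=\{0,1,2,\dots\}$), the set $X_3(n)$ is uncountable.
   Context: For an irrational $x$, its Lagrange value is $k(x)=\sup\{c>0 : |x-p/q|<\frac{1}{cq^2}$ has infinitely many rational solutions $p/q\}$. For $n\in\mathbb{N}\cup\{\infty\}$, $X_3(n)$ denotes the set of irrationals $x$ with $k(x)=3$ such that the inequality $|x-p/q|<\frac{1}{3q^2}$ has exactly $n$ rational solutions $p/q$ (for $n=\infty$: infinitely many solutions). *)

theory Defs
  imports Complex_Main "HOL-Library.Extended_Real" "HOL-Library.Countable_Set"
begin

text \<open>
  Solutions are counted as rational numbers, each written in lowest terms with positive
  denominator, and not as pairs \<open>(p, q)\<close>.  Dropping the coprimality condition gives the same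
  set for \<open>c > 0\<close>, because passing to lowest terms only enlarges the right-hand side.
\<close>

definition approx_solutions :: "real \<Rightarrow> real \<Rightarrow> real set" where
  "approx_solutions c x =
     {of_int p / of_int q | p q :: int.
        q > 0 \<and> coprime p q \<and> \<bar>x - of_int p / of_int q\<bar> < 1 / (c * (of_int q)\<^sup>2)}"

text \<open>The supremum is taken in the extended reals, since it is infinite for some irrational \<open>x\<close>.\<close>

definition lagrange_value :: "real \<Rightarrow> ereal" where
  "lagrange_value x = (SUP c \<in> {c :: real. c > 0 \<and> infinite (approx_solutions c x)}. ereal c)"

definition has_exactly :: "'a set \<Rightarrow> enat \<Rightarrow> bool" where
  "has_exactly S n \<longleftrightarrow>
     (case n of enat k \<Rightarrow> finite S \<and> card S = k | \<infinity> \<Rightarrow> infinite S)"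

definition X3 :: "enat \<Rightarrow> real set" where
  "X3 n = {x. x \<notin> \<rat> \<and> lagrange_value x = 3 \<and> has_exactly (approx_solutions 3 x) n}"

end

theory Submission
  imports Defs "HOL-Analysis.Kronecker_Approximation_Theorem"
begin

text \<open>By Legendre's theorem the solutions of \<open>\<bar>x - p / q\<bar> < 1 / (3 * q\<^sup>2)\<close> are the convergents for
  which \<open>M = d\<^sub>i + [0; d\<^sub>i\<^sub>+\<^sub>1, \<dots>] + [0; d\<^sub>i\<^sub>-\<^sub>1, \<dots>, d\<^sub>0]\<close> exceeds \<open>3\<close>.  Take the partial quotients from
  the word \<open>w k = \<lfloor>(k + 1) * \<alpha>\<rfloor> - \<lfloor>k * \<alpha>\<rfloor>\<close>, \<open>k \<ge> 1\<close>, with \<open>\<alpha>\<close> irrational, replacing \<open>0\<close> by \<open>2, 2\<close> and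
  \<open>1\<close> by \<open>1, 1\<close>.  Since \<open>[0; 2, X] + [0; 1, 1, X] = 1\<close>, the sign of \<open>M - 3\<close> at a factor \<open>01\<close> or \<open>10\<close> of the
  word is decided by comparing lexicographically what follows the factor with the reversal of what
  precedes it.  In terms of partial sums this is an inequality between integer parts of multiples
  of \<open>\<alpha>\<close>, and it always gives \<open>M < 3\<close>, except possibly if the whole reversed prefix agrees with what
  follows.  In that case what stands in front of the word decides: nothing gives \<open>M > 3\<close>, a
  partial quotient \<open>2\<close> gives \<open>M < 3\<close>, and \<open>n\<close> further partial quotients \<open>3\<close> give exactly \<open>n\<close>
  solutions.  The agreement occurs, and \<open>M\<close> comes arbitrarily close to \<open>3\<close>, whenever a multiple of \<open>\<alpha>\<close>
  comes closer to an integer than all earlier ones, from below; for \<open>\<alpha>\<close> or \<open>1 - \<alpha>\<close> this happens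
  infinitely often.\<close>

section \<open>Continued fractions and Legendre's theorem\<close>

text \<open>\<open>t i\<close> is the value of \<open>[0; d i, d (i + 1), \<dots>]\<close>.\<close>

definition cf_tails :: "(nat \<Rightarrow> nat) \<Rightarrow> (nat \<Rightarrow> real) \<Rightarrow> bool" where
  "cf_tails d t \<longleftrightarrow> (\<forall>i. d i \<ge> 1 \<and> 0 < t i \<and> t i < 1 \<and> t i * (d i + t (Suc i)) = 1)"

text \<open>Indices are shifted by one against the usual convention: the convergents are
  \<open>cf_num d (Suc i) / cf_den d (Suc i)\<close>, starting with \<open>0 / 1\<close>, and index \<open>0\<close> is the formal
  convergent \<open>1 / 0\<close>.\<close>

fun cf_den :: "(nat \<Rightarrow> nat) \<Rightarrow> nat \<Rightarrow> int" where
  "cf_den d 0 = 0"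
| "cf_den d (Suc 0) = 1"
| "cf_den d (Suc (Suc i)) = d i * cf_den d (Suc i) + cf_den d i"

fun cf_num :: "(nat \<Rightarrow> nat) \<Rightarrow> nat \<Rightarrow> int" where
  "cf_num d 0 = 1"
| "cf_num d (Suc 0) = 0"
| "cf_num d (Suc (Suc i)) = d i * cf_num d (Suc i) + cf_num d i"

text \<open>The expansion \<open>[0; d (i - 1), \<dots>, d 0]\<close> read backwards from position
  \<open>i\<close>.\<close>

fun cf_left :: "(nat \<Rightarrow> nat) \<Rightarrow> nat \<Rightarrow> real" where
  "cf_left d 0 = 0"
| "cf_left d (Suc i) = 1 / (d i + cf_left d i)"

definition cf_error :: "(nat \<Rightarrow> nat) \<Rightarrow> real \<Rightarrow> nat \<Rightarrow> real" where
  "cf_error d x i = real_of_int (cf_den d i) * x - real_of_int (cf_num d i)"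

text \<open>By \<open>cf_conv_dist\<close> below, the distance from \<open>t 0\<close> to its convergent with denominator
  \<open>q = cf_den d (Suc i)\<close> is \<open>1 / (cf_const d t i * q\<^sup>2)\<close>.\<close>

definition cf_const :: "(nat \<Rightarrow> nat) \<Rightarrow> (nat \<Rightarrow> real) \<Rightarrow> nat \<Rightarrow> real" where
  "cf_const d t i = d i + t (Suc i) + cf_left d i"

lemma cf_tailsD:
  assumes "cf_tails d t"
  shows "d i \<ge> 1" "0 < t i" "t i < 1" "t i = 1 / (d i + t (Suc i))" "1 / t i = d i + t (Suc i)"
proof -
  have *: "t i * (d i + t (Suc i)) = 1" "0 < t i"
    using assms by (auto simp: cf_tails_def)
  show "t i = 1 / (d i + t (Suc i))" "1 / t i = d i + t (Suc i)"
    using * by (metis mult_zero_right nonzero_eq_divide_eq zero_neq_one,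
        metis *(1) *(2) less_irrefl nonzero_mult_div_cancel_left)
qed (use assms in \<open>auto simp: cf_tails_def\<close>)

text \<open>The digit is the integer part of \<open>1 / t i\<close> and the next tail its fractional
  part, so the whole expansion is recovered from \<open>t 0\<close>.\<close>

lemma cf_tails_unique:
  assumes "cf_tails d t" "cf_tails d' t'" "t 0 = t' 0"
  shows "d = d'"
proof -
  have eq: "d i = d' i \<and> t (Suc i) = t' (Suc i)" if "t i = t' i" for i
  proof -
    note A = cf_tailsD[OF assms(1)] and B = cf_tailsD[OF assms(2)]
    have *: "d i + t (Suc i) = d' i + t' (Suc i)"
      using A(5)[of i] B(5)[of i] that by simp
    moreover have "\<bar>t (Suc i) - t' (Suc i)\<bar> < 1"
      using A(2,3)[of "Suc i"] B(2,3)[of "Suc i"] by linarith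
    ultimately have "\<bar>real (d i) - real (d' i)\<bar> < 1" by linarith
    then have "d i = d' i" by linarith
    then show ?thesis using * by simp
  qed
  have "t i = t' i" for i
    by (induction i) (use assms(3) eq in auto)
  then show ?thesis using eq by blast
qed

lemma cf_tails_prepend:
  assumes "cf_tails d t" "k \<ge> 1"
  shows "cf_tails (case_nat k d) (case_nat (1 / (k + t 0)) t)"
proof -
  have "real k + t 0 > 1" using cf_tailsD(2)[OF assms(1), of 0] assms(2) by linarith
  then show ?thesis
    using assms by (auto simp: cf_tails_def split: nat.splits)
qed

text \<open>Supplies the block of partial quotients \<open>3\<close>; the tails behind the block are
  kept, so estimates on them carry over.\<close>

lemma cf_tails_prepend_replicate:
  assumes "cf_tails d t" "k \<ge> 1"
  shows "\<exists>t'. cf_tails (\<lambda>i. if i < n then k else d (i - n)) t' \<and> (\<forall>i. t' (i + n) = t i)"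
proof (induction n)
  case 0
  then show ?case using assms by auto
next
  case (Suc n)
  then obtain t' where t': "cf_tails (\<lambda>i. if i < n then k else d (i - n)) t'" "\<forall>i. t' (i + n) = t i"
    by blast
  have "case_nat k (\<lambda>i. if i < n then k else d (i - n)) = (\<lambda>i. if i < Suc n then k else d (i - Suc n))"
    by (auto split: nat.splits)
  then have "cf_tails (\<lambda>i. if i < Suc n then k else d (i - Suc n)) (case_nat (1 / (k + t' 0)) t')"
    using cf_tails_prepend[OF t'(1) assms(2)] by simp
  then show ?case using t'(2) by (intro exI conjI) (assumption, simp)
qed

section \<open>Convergents: denominators, errors and distances\<close>

context
  fixes d :: "nat \<Rightarrow> nat" and t :: "nat \<Rightarrow> real"
  assumes cf: "cf_tails d t"
begin

lemmas cfD = cf_tailsD[OF cf]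

lemma cf_den_nonneg: "cf_den d i \<ge> 0"
  by (induction d i rule: cf_den.induct) auto

lemma cf_den_Suc_pos: "cf_den d (Suc i) > 0"
proof (induction i)
  case (Suc i)
  have "int (d i) * cf_den d (Suc i) > 0"
    using Suc cfD(1)[of i] by simp
  then show ?case using cf_den_nonneg[of i] by simp
qed simp

lemma cf_den_mono: "cf_den d (Suc i) \<le> cf_den d (Suc (Suc i))"
proof -
  have "1 * cf_den d (Suc i) \<le> int (d i) * cf_den d (Suc i)"
    using cfD(1)[of i] cf_den_Suc_pos[of i] by (intro mult_right_mono) auto
  then show ?thesis using cf_den_nonneg[of i] by simp
qed

lemma cf_den_ge: "cf_den d (Suc (Suc i)) \<ge> int i"
proof (induction i)
  case (Suc i)
  have "1 * cf_den d (Suc (Suc i)) \<le> int (d (Suc i)) * cf_den d (Suc (Suc i))"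
    using cfD(1)[of "Suc i"] cf_den_Suc_pos[of "Suc i"] by (intro mult_right_mono) auto
  moreover have "cf_den d (Suc i) \<ge> 1" using cf_den_Suc_pos[of i] by simp
  ultimately show ?case using Suc by simp
qed (use cf_den_Suc_pos in \<open>simp add: cf_den_nonneg\<close>)

text \<open>Dividing the recurrence of the denominators by the middle one turns it into the
  recursion of \<open>cf_left\<close>.\<close>

lemma cf_left_eq: "cf_left d i = cf_den d i / cf_den d (Suc i)"
proof (induction i)
  case (Suc i)
  have "real_of_int (cf_den d (Suc i)) > 0" using cf_den_Suc_pos by simp
  moreover from this have "real_of_int (cf_den d (Suc (Suc i)))
      = cf_den d (Suc i) * (d i + cf_left d i)"
    by (simp add: Suc field_simps)
  ultimately show ?case
    by (simp del: cf_den.simps(3))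
qed simp

lemma cf_left_bounds: "0 \<le> cf_left d i" "cf_left d i \<le> 1"
proof -
  show "0 \<le> cf_left d i"
    unfolding cf_left_eq using cf_den_nonneg by simp
  show "cf_left d i \<le> 1"
  proof (cases i)
    case (Suc j)
    then show ?thesis
      unfolding cf_left_eq using cf_den_mono[of j] cf_den_Suc_pos[of i]
      by (simp del: cf_den.simps)
  qed simp
qed

lemma cf_det: "cf_den d (Suc i) * cf_num d i - cf_den d i * cf_num d (Suc i) = (-1) ^ i"
  by (induction i) (auto simp: algebra_simps)

lemma cf_coprime: "coprime (cf_num d i) (cf_den d i)"
proof (rule coprimeI)
  fix c assume "c dvd cf_num d i" "c dvd cf_den d i"
  then have "c dvd cf_den d (Suc i) * cf_num d i - cf_den d i * cf_num d (Suc i)"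
    by (intro dvd_diff dvd_mult dvd_mult2)
  then have "c dvd (-1) ^ i" by (simp add: cf_det)
  then show "is_unit c" by (cases "even i") auto
qed

abbreviation "cf_err \<equiv> cf_error d (t 0)"

text \<open>The recurrence of the errors has the same shape as
  \<open>1 / t i = d i + t (Suc i)\<close>. Nonvanishing, decrease and alternating signs all follow
  from the factor \<open>- t i\<close> between \<open>-1\<close> and \<open>0\<close>.\<close>

lemma cf_err_Suc: "cf_err (Suc i) = - t i * cf_err i"
proof (induction i)
  case (Suc i)
  have "cf_err (Suc (Suc i)) = d i * cf_err (Suc i) + cf_err i"
    by (simp add: cf_error_def algebra_simps)
  moreover have "cf_err i = - (1 / t i) * cf_err (Suc i)"
    using Suc cfD(2)[of i] by (simp add: field_simps)
  ultimately show ?case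
    by (simp add: cfD(5) algebra_simps)
qed (simp add: cf_error_def)

lemma cf_err_nonzero: "cf_err i \<noteq> 0"
proof (induction i)
  case (Suc i)
  then show ?case using cfD(2)[of i] by (simp add: cf_err_Suc)
qed (simp add: cf_error_def)

lemma cf_err_decr: "\<bar>cf_err (Suc i)\<bar> < \<bar>cf_err i\<bar>"
  using cfD(2,3)[of i] cf_err_nonzero[of i] by (simp add: cf_err_Suc abs_mult)

lemma cf_err_opposite: "cf_err (Suc i) * cf_err i < 0"
proof -
  have "cf_err i * cf_err i > 0"
    using cf_err_nonzero[of i] by (auto simp: zero_less_mult_iff)
  then have "t i * (cf_err i * cf_err i) > 0" using cfD(2)[of i] by simp
  then show ?thesis by (simp add: cf_err_Suc algebra_simps)
qed

text \<open>The determinant \<open>cf_det\<close> is a linear relation between two consecutive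
  errors; substituting \<open>cf_err_Suc\<close> leaves an equation for one of them.\<close>

lemma cf_err_abs: "\<bar>cf_err (Suc i)\<bar> = 1 / (cf_den d (Suc i) * cf_const d t i)"
proof -
  let ?Q = "real_of_int (cf_den d (Suc i))" and ?R = "real_of_int (cf_den d i)"
  have "?R * cf_err (Suc i) - ?Q * cf_err i = real_of_int (cf_den d (Suc i) * cf_num d i - cf_den d i * cf_num d (Suc i))"
    by (simp add: cf_error_def algebra_simps)
  also have "\<dots> = (-1) ^ i" by (simp add: cf_det del: of_int_diff of_int_mult)
  finally have *: "cf_err i * (t i * ?R + ?Q) = - ((-1) ^ i)"
    by (simp add: cf_err_Suc algebra_simps)
  have t: "t i > 0" and Q: "?Q > 0" and R: "?R \<ge> 0"
    using cfD(2) cf_den_Suc_pos cf_den_nonneg by auto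
  have "\<bar>cf_err i\<bar> * \<bar>t i * ?R + ?Q\<bar> = 1"
    using arg_cong[OF *, of abs] by (simp add: abs_mult)
  moreover have p: "t i * ?R + ?Q > 0" using t Q R by (simp add: add_nonneg_pos)
  ultimately have "\<bar>cf_err i\<bar> = 1 / (t i * ?R + ?Q)"
    by (simp add: field_simps)
  then have "\<bar>cf_err (Suc i)\<bar> = t i / (t i * ?R + ?Q)"
    using t by (simp add: cf_err_Suc abs_mult)
  moreover have "?Q * cf_const d t i = (t i * ?R + ?Q) / t i"
    using t Q by (simp add: cf_const_def cf_left_eq add_divide_distrib distrib_left flip: cfD(5))
  ultimately show ?thesis by simp
qed

lemma cf_const_pos: "cf_const d t i > 0"
  using cfD(2)[of "Suc i"] cf_left_bounds(1)[of i] by (simp add: cf_const_def)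

abbreviation "cf_conv i \<equiv> real_of_int (cf_num d (Suc i)) / real_of_int (cf_den d (Suc i))"

lemma cf_conv_error:
  "t 0 - cf_conv i = cf_err (Suc i) / cf_den d (Suc i)"
  using cf_den_Suc_pos[of i] by (simp add: cf_error_def field_simps)

lemma cf_conv_dist:
  "\<bar>t 0 - cf_conv i\<bar> = 1 / (cf_const d t i * (real_of_int (cf_den d (Suc i)))\<^sup>2)"
  using cf_den_Suc_pos[of i]
  by (simp add: cf_conv_error cf_err_abs abs_divide power2_eq_square mult_ac)

text \<open>The distances to \<open>t 0\<close> strictly decrease. This allows solutions to be
  counted by their indices.\<close>

lemma cf_conv_inj: "inj cf_conv"
proof -
  have step: "\<bar>t 0 - cf_conv (Suc i)\<bar> < \<bar>t 0 - cf_conv i\<bar>" for i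
  proof -
    have "\<bar>cf_err (Suc (Suc i))\<bar> / cf_den d (Suc (Suc i)) \<le> \<bar>cf_err (Suc (Suc i))\<bar> / cf_den d (Suc i)"
      using cf_den_mono[of i] cf_den_Suc_pos[of i] cf_den_Suc_pos[of "Suc i"]
      by (intro divide_left_mono) (auto simp del: cf_den.simps)
    also have "\<dots> < \<bar>cf_err (Suc i)\<bar> / cf_den d (Suc i)"
      using cf_err_decr[of "Suc i"] cf_den_Suc_pos[of i] by (intro divide_strict_right_mono) auto
    finally show ?thesis
      using cf_den_Suc_pos[of i] cf_den_Suc_pos[of "Suc i"]
      by (simp add: cf_conv_error del: cf_den.simps cf_num.simps)
  qed
  have dec: "\<bar>t 0 - cf_conv j\<bar> < \<bar>t 0 - cf_conv i\<bar>" if "i < j" for i j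
    using that
  proof (induction j)
    case (Suc j)
    then have "i = j \<or> \<bar>t 0 - cf_conv j\<bar> < \<bar>t 0 - cf_conv i\<bar>"
      by (auto simp: less_Suc_eq simp del: cf_den.simps cf_num.simps)
    then show ?case using step[of j] less_trans by blast
  qed simp
  show ?thesis
    by (rule linorder_injI) (use dec in fastforce)
qed

text \<open>If \<open>t 0 = a / b\<close>, then \<open>b * cf_err (Suc i)\<close> is a nonzero
  integer of absolute value at most \<open>b / cf_den d (Suc i)\<close>. This would bound the
  denominators, contrary to \<open>cf_den_ge\<close>.\<close>

lemma cf_irrational: "t 0 \<notin> \<rat>"
proof
  assume "t 0 \<in> \<rat>"
  then obtain a b :: int where b: "b > 0" and x: "t 0 = a / b"
    by (metis Rats_cases' )
  have "real_of_int (cf_den d (Suc i)) \<le> b" for i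
  proof -
    have "b * cf_err (Suc i) = of_int (cf_den d (Suc i) * a - b * cf_num d (Suc i))"
      using b by (simp add: cf_error_def x field_simps)
    moreover have "b * cf_err (Suc i) \<noteq> 0" using b cf_err_nonzero by simp
    ultimately have "1 \<le> \<bar>b * cf_err (Suc i)\<bar>"
      by (metis of_int_0_eq_iff of_int_1_le_iff of_int_abs zero_less_abs_iff int_one_le_iff_zero_less)
    then have "1 \<le> b * \<bar>cf_err (Suc i)\<bar>" using b by (simp add: abs_mult)
    also have "\<dots> \<le> b * (1 / cf_den d (Suc i))"
    proof -
      have "cf_const d t i \<ge> 1"
        using cfD(1)[of i] cfD(2)[of "Suc i"] cf_left_bounds(1)[of i] by (simp add: cf_const_def)
      then have "1 / (cf_den d (Suc i) * cf_const d t i) \<le> 1 / (cf_den d (Suc i) * 1)"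
        using cf_den_Suc_pos[of i] by (intro divide_left_mono mult_left_mono) auto
      then show ?thesis using b unfolding cf_err_abs by (intro mult_left_mono) auto
    qed
    finally show ?thesis using cf_den_Suc_pos[of i] by (simp add: field_simps)
  qed
  from this[of "Suc (nat b + 1)"] show False
    using cf_den_ge[of "nat b + 1"] b by (simp del: cf_den.simps)
qed

section \<open>Best approximation and Legendre's criterion\<close>

lemma cf_index:
  fixes q :: int
  assumes "q > 0"
  obtains i where "cf_den d (Suc i) \<le> q" "q < cf_den d (Suc (Suc i))"
proof -
  have ex: "\<exists>i. q < cf_den d (Suc (Suc i))"
    using cf_den_ge[of "nat q + 1"] assms by (intro exI[of _ "nat q + 1"]) (simp del: cf_den.simps)
  define i where "i = (LEAST i. q < cf_den d (Suc (Suc i)))"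
  have 1: "q < cf_den d (Suc (Suc i))" unfolding i_def by (rule LeastI_ex[OF ex])
  have "cf_den d (Suc i) \<le> q"
  proof (cases i)
    case (Suc j)
    then have "\<not> q < cf_den d (Suc (Suc j))"
      using not_less_Least[of j "\<lambda>i. q < cf_den d (Suc (Suc i))"] i_def by simp
    then show ?thesis using Suc by simp
  qed (use assms in simp)
  then show ?thesis using 1 that by blast
qed

text \<open>The pair \<open>(p, q)\<close> is an integer combination of two neighbouring
  convergents. The range of \<open>q\<close> forces \<open>u \<noteq> 0\<close> and
  \<open>u * v \<le> 0\<close>; as the errors alternate in sign, the two contributions cannot
  cancel.\<close>

lemma cf_best_approx:
  fixes p q :: int
  assumes "q > 0" "cf_den d (Suc i) \<le> q" "q < cf_den d (Suc (Suc i))"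
  shows "\<bar>cf_err (Suc i)\<bar> \<le> \<bar>q * t 0 - p\<bar>"
proof -
  let ?Q = "cf_den d (Suc i)" and ?Q' = "cf_den d (Suc (Suc i))"
  let ?P = "cf_num d (Suc i)" and ?P' = "cf_num d (Suc (Suc i))"
  define s :: int where "s = (-1) ^ Suc i"
  have ss: "s * s = 1" by (simp add: s_def flip: power_add)
  have det: "?Q' * ?P - ?Q * ?P' = s" unfolding s_def by (rule cf_det)
  \<comment> \<open>Cramer's rule; the determinant \<open>s\<close> is its own inverse.\<close>
  define u v where "u = s * (?Q' * p - q * ?P')" and "v = s * (q * ?P - ?Q * p)"
  have "u * ?Q + v * ?Q' = s * q * (?Q' * ?P - ?Q * ?P')"
    unfolding u_def v_def by algebra
  also have "\<dots> = q" using det ss by (metis mult.assoc mult.commute mult_1)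
  finally have q: "q = u * ?Q + v * ?Q'" by simp
  have "u * ?P + v * ?P' = s * p * (?Q' * ?P - ?Q * ?P')"
    unfolding u_def v_def by algebra
  also have "\<dots> = p" using det ss by (metis mult.assoc mult.commute mult_1)
  finally have p: "p = u * ?P + v * ?P'" by simp
  have Q: "?Q > 0" "?Q' > 0" using cf_den_Suc_pos by blast+
  have err: "q * t 0 - p = u * cf_err (Suc i) + v * cf_err (Suc (Suc i))"
    by (simp add: cf_error_def q p algebra_simps del: cf_den.simps cf_num.simps)
  have "u \<noteq> 0"
  proof
    assume "u = 0"
    then have "v * ?Q' = q" "q > 0" using q assms by auto
    then have "v > 0" using Q by (metis zero_less_mult_pos2)
    then have "v * ?Q' \<ge> 1 * ?Q'" using Q by (intro mult_right_mono) auto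
    then show False using assms \<open>v * ?Q' = q\<close> by linarith
  qed
  have "u * v \<le> 0"
  proof (rule ccontr)
    assume "\<not> u * v \<le> 0"
    then consider "u > 0" "v > 0" | "u < 0" "v < 0" by (auto simp: not_le zero_less_mult_iff)
    then show False
    proof cases
      case 1
      then have "u * ?Q > 0" "v * ?Q' \<ge> 1 * ?Q'"
        using Q by (simp, intro mult_right_mono, auto)
      then show ?thesis using q assms by linarith
    next
      case 2
      then have "u * ?Q < 0" "v * ?Q' < 0" using Q by (simp_all add: mult_neg_pos del: cf_den.simps)
      then show ?thesis using q assms by linarith
    qed
  qed
  then have "real_of_int (u * v) \<le> 0" by linarith
  then have uv: "real_of_int u * real_of_int v \<le> 0" by simp
  have "(u * cf_err (Suc i)) * (v * cf_err (Suc (Suc i))) \<ge> 0"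
  proof -
    have "(u * cf_err (Suc i)) * (v * cf_err (Suc (Suc i)))
        = (real_of_int u * real_of_int v) * (cf_err (Suc (Suc i)) * cf_err (Suc i))"
      by (simp add: algebra_simps)
    then show ?thesis
      using mult_nonpos_nonpos[OF uv less_imp_le[OF cf_err_opposite[of "Suc i"]]] by argo
  qed
  then have "\<bar>u * cf_err (Suc i)\<bar> \<le> \<bar>q * t 0 - p\<bar>"
    unfolding err by (auto simp: zero_le_mult_iff)
  moreover have "1 * \<bar>cf_err (Suc i)\<bar> \<le> \<bar>real_of_int u\<bar> * \<bar>cf_err (Suc i)\<bar>"
    using \<open>u \<noteq> 0\<close> by (intro mult_right_mono) auto
  ultimately show ?thesis by (simp add: abs_mult)
qed

text \<open>Compare \<open>p / q\<close> with the convergent whose denominator is the last one not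
  above \<open>q\<close>. If they differ, the cross difference is a nonzero integer, but best
  approximation bounds it strictly by \<open>1 / 2 + 1 / 2\<close>.\<close>

lemma cf_legendre:
  fixes p q :: int
  assumes "q > 0" "\<bar>t 0 - p / q\<bar> < 1 / (2 * (real_of_int q)\<^sup>2)"
  shows "\<exists>i. p / q = cf_conv i"
proof -
  obtain i where i: "cf_den d (Suc i) \<le> q" "q < cf_den d (Suc (Suc i))"
    using cf_index[OF assms(1)] .
  let ?Q = "cf_den d (Suc i)" and ?P = "cf_num d (Suc i)"
  have Q: "?Q > 0" by (rule cf_den_Suc_pos)
  have lt: "\<bar>q * t 0 - p\<bar> < 1 / (2 * q)"
  proof -
    have "\<bar>q * t 0 - p\<bar> = q * \<bar>t 0 - p / q\<bar>"
    proof -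
      have "q * t 0 - p = q * (t 0 - p / q)" using assms(1) by (simp add: field_simps)
      then show ?thesis using assms(1) by (simp only: abs_mult)
    qed
    also have "\<dots> < q * (1 / (2 * (real_of_int q)\<^sup>2))" using assms by (intro mult_strict_left_mono) auto
    also have "\<dots> = 1 / (2 * q)" using assms(1) by (simp add: power2_eq_square)
    finally show ?thesis .
  qed
  have "p * ?Q = ?P * q"
  proof (rule ccontr)
    assume "p * ?Q \<noteq> ?P * q"
    then have "1 \<le> \<bar>p * ?Q - ?P * q\<bar>" by linarith
    then have "1 \<le> \<bar>real_of_int (p * ?Q - ?P * q)\<bar>" by linarith
    also have "real_of_int (p * ?Q - ?P * q) = q * cf_err (Suc i) - ?Q * (q * t 0 - p)"
      by (simp add: cf_error_def algebra_simps)
    also have "\<bar>\<dots>\<bar> \<le> \<bar>q * cf_err (Suc i)\<bar> + \<bar>?Q * (q * t 0 - p)\<bar>" by (rule abs_triangle_ineq4)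
    also have "\<dots> = q * \<bar>cf_err (Suc i)\<bar> + ?Q * \<bar>q * t 0 - p\<bar>" using Q assms(1) by (simp add: abs_mult)
    also have "\<dots> < q * (1 / (2 * q)) + ?Q * (1 / (2 * q))"
      using cf_best_approx[OF assms(1) i, of p] lt Q assms(1)
      by (intro add_strict_mono mult_strict_left_mono) auto
    also have "\<dots> \<le> q * (1 / (2 * q)) + q * (1 / (2 * q))"
      using i(1) assms(1) by (intro add_left_mono mult_right_mono) auto
    finally show False using assms(1) by simp
  qed
  then have "real_of_int p * ?Q = ?P * q" by (metis of_int_mult)
  then have "p / q = cf_conv i" using Q assms(1) by (simp add: field_simps)
  then show ?thesis by blast
qed

section \<open>Solutions in terms of the approximation constants\<close>

lemma cf_conv_in_approx_solutions_iff:
  fixes c :: real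
  assumes "c > 0"
  shows "\<bar>t 0 - cf_conv i\<bar> < 1 / (c * (real_of_int (cf_den d (Suc i)))\<^sup>2) \<longleftrightarrow> c < cf_const d t i"
proof -
  have "real_of_int (cf_den d (Suc i)) > 0" using cf_den_Suc_pos by simp
  then show ?thesis
    unfolding cf_conv_dist using assms cf_const_pos[of i]
    by (simp add: field_simps)
qed

text \<open>The lower bound on the Lagrange value uses this inclusion for \<open>c\<close> that may
  lie below \<open>2\<close>, outside the range of Legendre's theorem.\<close>

lemma approx_solutions_supset:
  assumes "c > 0"
  shows "cf_conv ` {i. c < cf_const d t i} \<subseteq> approx_solutions c (t 0)"
proof
  fix y assume "y \<in> cf_conv ` {i. c < cf_const d t i}"
  then obtain i where i: "y = cf_conv i" "c < cf_const d t i" by blast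
  then have "\<bar>t 0 - cf_conv i\<bar> < 1 / (c * (real_of_int (cf_den d (Suc i)))\<^sup>2)"
    using cf_conv_in_approx_solutions_iff[OF assms] by blast
  then show "y \<in> approx_solutions c (t 0)"
    unfolding approx_solutions_def i(1) using cf_den_Suc_pos[of i] cf_coprime[of "Suc i"] by blast
qed

lemma approx_solutions_eq:
  assumes "c \<ge> 2"
  shows "approx_solutions c (t 0) = cf_conv ` {i. c < cf_const d t i}"
proof
  show "approx_solutions c (t 0) \<subseteq> cf_conv ` {i. c < cf_const d t i}"
  proof
    fix y assume "y \<in> approx_solutions c (t 0)"
    then obtain p q :: int where pq: "y = p / q" "q > 0" "coprime p q"
      "\<bar>t 0 - p / q\<bar> < 1 / (c * (of_int q)\<^sup>2)"
      unfolding approx_solutions_def by blast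
    have "1 / (c * (real_of_int q)\<^sup>2) \<le> 1 / (2 * (real_of_int q)\<^sup>2)"
      using assms pq(2) by (intro divide_left_mono mult_right_mono) auto
    then obtain i where i: "p / q = cf_conv i"
      using cf_legendre[OF pq(2), of p] pq(4) by auto
    \<comment> \<open>Both fractions are in lowest terms, so equality of values gives equality of
      denominators, on which the bound depends.\<close>
    have "q = cf_den d (Suc i)"
    proof -
      have "p * cf_den d (Suc i) = cf_num d (Suc i) * q"
      proof -
        have "real_of_int p * cf_den d (Suc i) = cf_num d (Suc i) * real_of_int q"
          using i pq(2) cf_den_Suc_pos[of i] by (simp add: field_simps)
        then show ?thesis by (metis of_int_mult of_int_eq_iff)
      qed
      then have "q dvd cf_den d (Suc i) " "cf_den d (Suc i) dvd q"
        using pq(3) cf_coprime[of "Suc i"]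
        by (metis coprime_commute coprime_dvd_mult_right_iff dvd_triv_right,
            metis coprime_commute coprime_dvd_mult_right_iff dvd_triv_right)
      then show ?thesis using pq(2) cf_den_Suc_pos[of i] by (simp add: zdvd_antisym_nonneg)
    qed
    then have "c < cf_const d t i"
      using pq(4) cf_conv_in_approx_solutions_iff[of c i] assms unfolding i by simp
    then show "y \<in> cf_conv ` {i. c < cf_const d t i}" using pq(1) i by blast
  qed
qed (use approx_solutions_supset[of c] assms in simp)

text \<open>Reduces membership to the sequence of constants: \<open>above\<close> and
  \<open>below\<close> say that its limit superior is \<open>3\<close>, and \<open>num\<close>
  counts the terms beyond \<open>3\<close>.\<close>

lemma cf_in_X3:
  assumes above: "\<And>e. e > 0 \<Longrightarrow> finite {i. 3 + e < cf_const d t i}"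
    and below: "\<And>e. e > 0 \<Longrightarrow> infinite {i. 3 - e < cf_const d t i}"
    and num: "has_exactly {i. 3 < cf_const d t i} n"
  shows "t 0 \<in> X3 n"
proof -
  have inj: "inj_on cf_conv A" for A using cf_conv_inj by (rule inj_on_subset) simp
  have "lagrange_value (t 0) = 3"
    unfolding lagrange_value_def
  proof (rule antisym)
    show "(SUP c\<in>{c. 0 < c \<and> infinite (approx_solutions c (t 0))}. ereal c) \<le> 3"
    proof (rule SUP_least)
      fix c assume c: "c \<in> {c. 0 < c \<and> infinite (approx_solutions c (t 0))}"
      have "c \<le> 3"
      proof (rule ccontr)
        assume "\<not> c \<le> 3"
        then have "finite {i. 3 + (c - 3) < cf_const d t i}" by (intro above) simp
        then show False using c \<open>\<not> c \<le> 3\<close> by (simp add: approx_solutions_eq)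
      qed
      then show "ereal c \<le> 3" by simp
    qed
    show "3 \<le> (SUP c\<in>{c. 0 < c \<and> infinite (approx_solutions c (t 0))}. ereal c)"
    proof (rule le_SUP_iff[THEN iffD2], intro allI impI)
      fix y :: ereal assume y: "y < 3"
      obtain c where c: "y < ereal c" "c < 3" "c > 0"
      proof -
        \<comment> \<open>The maximum with \<open>0\<close> makes \<open>c\<close> positive, since
          \<open>y\<close> may be negative.\<close>
        have "max y 0 < 3" using y by simp
        then obtain c where "max y 0 < ereal c" "ereal c < 3" using ereal_dense2 by blast
        then show ?thesis using that by auto
      qed
      have "infinite {i. c < cf_const d t i}" using below[of "3 - c"] c by simp
      then have "infinite (cf_conv ` {i. c < cf_const d t i})"
        using finite_imageD[OF _ inj] by blast
      then have "infinite (approx_solutions c (t 0))"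
        using approx_solutions_supset[OF c(3)] finite_subset by blast
      then show "\<exists>i\<in>{c. 0 < c \<and> infinite (approx_solutions c (t 0))}. y < ereal i"
        using c by blast
    qed
  qed
  moreover have "has_exactly (approx_solutions 3 (t 0)) n"
    using num by (auto simp: approx_solutions_eq has_exactly_def card_image[OF inj]
        finite_image_iff[OF inj] split: enat.splits)
  ultimately show ?thesis using cf_irrational by (simp add: X3_def)
qed

end

section \<open>Values of words in the blocks 22 and 11\<close>

text \<open>The letter \<open>0\<close> stands for the partial quotients \<open>2, 2\<close> and any other letter for \<open>1, 1\<close>.\<close>

definition letter_map :: "nat \<Rightarrow> real \<Rightarrow> real" where
  "letter_map a s = (if a = 0 then 1 / (2 + 1 / (2 + s)) else 1 / (1 + 1 / (1 + s)))"

text \<open>The seed \<open>s\<close> is the value of whatever lies beyond the \<open>m\<close>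
  letters: a later tail or, for a reversed word, what stands in front of it.\<close>

fun word_map :: "nat \<Rightarrow> (nat \<Rightarrow> nat) \<Rightarrow> real \<Rightarrow> real" where
  "word_map 0 x s = s"
| "word_map (Suc m) x s = letter_map (x 0) (word_map m (\<lambda>j. x (Suc j)) s)"

lemma letter_map_eq:
  assumes "s \<ge> 0"
  shows "letter_map 0 s = (2 + s) / (5 + 2 * s)" "letter_map (Suc 0) s = (1 + s) / (2 + s)"
  using assms by (auto simp: letter_map_def field_simps)

lemma letter_map_cases: "letter_map a = letter_map 0 \<or> letter_map a = letter_map (Suc 0)"
  by (auto simp: letter_map_def fun_eq_iff)

text \<open>The images of the unit interval under the two letters, \<open>[2/5, 3/7]\<close> here
  and \<open>[1/2, 2/3]\<close> below, are disjoint, so the first differing letter decides a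
  comparison.\<close>

lemma letter_map_0_bounds:
  assumes "0 \<le> s" "s \<le> 1"
  shows "2 / 5 \<le> letter_map 0 s" "letter_map 0 s \<le> 3 / 7" "s < 1 \<Longrightarrow> letter_map 0 s < 3 / 7"
  using assms by (auto simp: letter_map_eq field_simps)

lemma letter_map_1_bounds:
  assumes "0 \<le> s" "s \<le> 1"
  shows "1 / 2 \<le> letter_map (Suc 0) s" "letter_map (Suc 0) s \<le> 2 / 3" "0 < s \<Longrightarrow> 1 / 2 < letter_map (Suc 0) s"
  using assms by (auto simp: letter_map_eq field_simps)

lemma letter_map_bounds:
  assumes "0 \<le> s" "s \<le> 1"
  shows "2 / 5 \<le> letter_map a s" "letter_map a s \<le> 2 / 3"
  using letter_map_cases[of a] letter_map_0_bounds[OF assms] letter_map_1_bounds[OF assms] by auto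

text \<open>Both letters act as Moebius maps of determinant \<open>1\<close>, so the difference of
  two values is \<open>s' - s\<close> divided by the product of the denominators, which is at least
  \<open>4\<close>.\<close>

lemma letter_map_diff:
  assumes "0 \<le> s" "s \<le> s'"
  shows "letter_map a s \<le> letter_map a s'" "letter_map a s' - letter_map a s \<le> (s' - s) / 4"
    "s < s' \<Longrightarrow> letter_map a s < letter_map a s'"
proof -
  have 0: "letter_map 0 s' - letter_map 0 s = (s' - s) / ((5 + 2 * s) * (5 + 2 * s'))"
    using assms by (simp add: letter_map_eq divide_simps) (simp add: algebra_simps)
  have 1: "letter_map (Suc 0) s' - letter_map (Suc 0) s = (s' - s) / ((2 + s) * (2 + s'))"
    using assms by (simp add: letter_map_eq divide_simps) (simp add: algebra_simps)
  have p: "5 * 5 \<le> (5 + 2 * s) * (5 + 2 * s')" "2 * 2 \<le> (2 + s) * (2 + s')"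
    using assms by (intro mult_mono; simp)+
  have "\<exists>D \<ge> 4. letter_map a s' - letter_map a s = (s' - s) / D"
    using letter_map_cases[of a]
  proof
    assume "letter_map a = letter_map 0"
    then show ?thesis using 0 p(1) by (intro exI[of _ "(5 + 2 * s) * (5 + 2 * s')"]) simp
  next
    assume "letter_map a = letter_map (Suc 0)"
    then show ?thesis using 1 p(2) by (intro exI[of _ "(2 + s) * (2 + s')"]) simp
  qed
  then obtain D where D: "D \<ge> 4" "letter_map a s' - letter_map a s = (s' - s) / D" by blast
  have "(s' - s) / D \<le> (s' - s) / 4" using D(1) assms by (intro divide_left_mono) auto
  then show "letter_map a s' - letter_map a s \<le> (s' - s) / 4" using D by simp
  have "(s' - s) / D \<ge> 0" using D(1) assms by simp
  then show "letter_map a s \<le> letter_map a s'" using D by simp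
  show "letter_map a s < letter_map a s'" if "s < s'"
  proof -
    have "(s' - s) / D > 0" using D(1) that by simp
    then show ?thesis using D by simp
  qed
qed

lemma letter_map_lipschitz:
  assumes "0 \<le> s" "0 \<le> s'"
  shows "\<bar>letter_map a s - letter_map a s'\<bar> \<le> \<bar>s - s'\<bar> / 4"
proof (cases "s \<le> s'")
  case True
  then show ?thesis using letter_map_diff(1,2)[OF assms(1) True, of a] by simp
next
  case False
  then have "s' \<le> s" by simp
  then show ?thesis using letter_map_diff(1,2)[OF assms(2), of s a] by simp
qed

lemma word_map_bounds:
  assumes "0 \<le> s" "s \<le> 1"
  shows "0 \<le> word_map m x s" "word_map m x s \<le> 1"
proof -
  have "0 \<le> word_map m x s \<and> word_map m x s \<le> 1"
  proof (induction m arbitrary: x)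
    case (Suc m)
    from letter_map_bounds[OF conjunct1[OF Suc] conjunct2[OF Suc]] show ?case
      by (smt (verit) word_map.simps(2) divide_nonneg_nonneg divide_le_eq_1)
  qed (use assms in simp)
  then show "0 \<le> word_map m x s" "word_map m x s \<le> 1" by auto
qed

lemma word_map_mono:
  assumes "0 \<le> s" "s \<le> s'" "s' \<le> 1"
  shows "word_map m x s \<le> word_map m x s'"
  by (induction m arbitrary: x) (use assms in \<open>auto intro!: letter_map_diff word_map_bounds\<close>)

lemma word_map_strict_mono:
  assumes "0 \<le> s" "s < s'" "s' \<le> 1"
  shows "word_map m x s < word_map m x s'"
proof (induction m arbitrary: x)
  case (Suc m)
  show ?case
    unfolding word_map.simps
    by (rule letter_map_diff(3)) (use Suc[of "\<lambda>j. x (Suc j)"] assms in \<open>auto intro!: word_map_bounds\<close>)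
qed (use assms in simp)

lemma word_map_lipschitz:
  assumes "0 \<le> s" "s \<le> 1" "0 \<le> s'" "s' \<le> 1"
  shows "\<bar>word_map m x s - word_map m x s'\<bar> \<le> (1 / 4) ^ m"
proof (induction m arbitrary: x)
  case (Suc m)
  have "\<bar>word_map (Suc m) x s - word_map (Suc m) x s'\<bar>
      \<le> \<bar>word_map m (\<lambda>j. x (Suc j)) s - word_map m (\<lambda>j. x (Suc j)) s'\<bar> / 4"
    unfolding word_map.simps using assms by (intro letter_map_lipschitz word_map_bounds)
  also have "\<dots> \<le> (1 / 4) ^ m / 4" using Suc by (intro divide_right_mono) auto
  finally show ?case by simp
qed (use assms in auto)

lemma word_map_snoc: "word_map (Suc m) x s = word_map m x (letter_map (x m) s)"
proof (induction m arbitrary: x)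
  case (Suc m)
  show ?case
    using Suc[of "\<lambda>j. x (Suc j)"] by (simp only: word_map.simps(2))
qed simp

lemma word_map_cong:
  assumes "\<And>j. j < m \<Longrightarrow> x j = y j"
  shows "word_map m x s = word_map m y s"
  using assms
proof (induction m arbitrary: x y)
  case (Suc m)
  have "word_map m (\<lambda>j. x (Suc j)) s = word_map m (\<lambda>j. y (Suc j)) s"
    by (rule Suc.IH) (use Suc.prems in blast)
  then show ?case using Suc.prems[of 0] by simp
qed simp

text \<open>Comparing partial sums is comparing lexicographically, and that is the order of the values,
  since each letter contributes an even number of partial quotients.\<close>

lemma word_map_less:
  assumes "\<And>k. k \<le> m \<Longrightarrow> sum x {..<k} \<le> sum y {..<k}" "j < m" "x j \<noteq> y j"
    and "0 \<le> s" "s \<le> 1" "0 \<le> s'" "s' \<le> 1" "\<And>j. y j \<le> 1"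
  shows "word_map m x s < word_map m y s'"
  using assms(1,2,3,8)
proof (induction m arbitrary: x y j)
  case (Suc m)
  define x' y' where "x' = (\<lambda>j. x (Suc j))" and "y' = (\<lambda>j. y (Suc j))"
  have xy: "x 0 \<le> y 0" using Suc.prems(1)[of 1] by simp
  have b: "0 \<le> word_map m x' s" "word_map m x' s \<le> 1" "0 \<le> word_map m y' s'" "word_map m y' s' \<le> 1"
    using assms by (auto intro!: word_map_bounds)
  show ?case
  proof (cases "x 0 = y 0")
    case True
    have *: "sum x' {..<k} \<le> sum y' {..<k}" if "k \<le> m" for k
      using Suc.prems(1)[of "Suc k"] that True by (simp only: sum.lessThan_Suc_shift x'_def y'_def) simp
    obtain j' where j': "j = Suc j'" using Suc.prems(3) True by (cases j) auto
    have "word_map m x' s < word_map m y' s'"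
      by (rule Suc.IH[OF *, of j']) (use Suc.prems j' in \<open>auto simp: x'_def y'_def\<close>)
    then show ?thesis
      using True b letter_map_diff(3) by (simp add: x'_def y'_def)
  next
    case False
    then have "x 0 = 0" "y 0 = 1" using xy Suc.prems(4)[of 0] by auto
    then show ?thesis
      using letter_map_0_bounds(2)[OF b(1,2)] letter_map_1_bounds(1)[OF b(3,4)]
      by (simp add: x'_def y'_def)
  qed
qed simp

section \<open>Values of infinite words\<close>

definition word_tail :: "(nat \<Rightarrow> nat) \<Rightarrow> nat \<Rightarrow> real" where
  "word_tail w k = lim (\<lambda>m. word_map m (\<lambda>j. w (k + j)) 0)"

text \<open>Appending a letter replaces the seed \<open>0\<close> by a nonnegative one, so the
  bounded approximations increase.\<close>

lemma word_map_0_convergent: "convergent (\<lambda>m. word_map m x 0)"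
proof (rule Bseq_monoseq_convergent)
  show "Bseq (\<lambda>m. word_map m x 0)"
    using word_map_bounds[of 0 _ x] by (intro BseqI'[of _ 1]) auto
  have "word_map m x 0 \<le> word_map (Suc m) x 0" for m
  proof -
    have "0 \<le> letter_map (x m) 0" "letter_map (x m) 0 \<le> 1"
      using letter_map_bounds[of 0 "x m"] by auto
    then show ?thesis
      unfolding word_map_snoc by (intro word_map_mono) auto
  qed
  then show "monoseq (\<lambda>m. word_map m x 0)"
    by (intro incseq_imp_monoseq incseq_SucI)
qed

lemma word_tail_lim: "(\<lambda>m. word_map m (\<lambda>j. w (k + j)) 0) \<longlonglongrightarrow> word_tail w k"
  unfolding word_tail_def using word_map_0_convergent by (rule convergent_LIMSEQ_iff[THEN iffD1])

lemma word_tail_bounds_weak: "0 \<le> word_tail w k" "word_tail w k \<le> 1"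
  using word_map_bounds[of 0 _ "\<lambda>j. w (k + j)"]
  by (auto intro!: LIMSEQ_le_const[OF word_tail_lim] LIMSEQ_le_const2[OF word_tail_lim])

lemma word_tail_Suc: "word_tail w k = letter_map (w k) (word_tail w (Suc k))"
proof (rule LIMSEQ_unique)
  show "(\<lambda>m. word_map (Suc m) (\<lambda>j. w (k + j)) 0) \<longlonglongrightarrow> word_tail w k"
    using word_tail_lim by (rule LIMSEQ_Suc)
  have "(\<lambda>m. letter_map (w k) (word_map m (\<lambda>j. w (Suc k + j)) 0)) \<longlonglongrightarrow> letter_map (w k) (word_tail w (Suc k))"
  proof -
    let ?s = "word_tail w (Suc k)"
    have s: "?s \<ge> 0" by (rule word_tail_bounds_weak)
    then have "1 + ?s \<noteq> 0" "2 + ?s \<noteq> 0" "1 + 1 / (1 + ?s) \<noteq> 0" "2 + 1 / (2 + ?s) \<noteq> 0"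
      by (auto simp: add_nonneg_eq_0_iff)
    then show ?thesis
      unfolding letter_map_def by (auto intro!: tendsto_intros word_tail_lim[of w "Suc k", simplified])
  qed
  then show "(\<lambda>m. word_map (Suc m) (\<lambda>j. w (k + j)) 0) \<longlonglongrightarrow> letter_map (w k) (word_tail w (Suc k))"
    by simp
qed

lemma word_tail_bounds: "2 / 5 \<le> word_tail w k" "word_tail w k \<le> 2 / 3"
  unfolding word_tail_Suc[of w k] using letter_map_bounds word_tail_bounds_weak by blast+

lemma word_tail_shift: "word_tail w k = word_map m (\<lambda>j. w (k + j)) (word_tail w (k + m))"
proof (induction m)
  case (Suc m)
  then show ?case unfolding word_map_snoc using word_tail_Suc[of w "k + m"] by simp
qed simp

section \<open>Slope words\<close>

text \<open>The mechanical word of slope \<open>\<alpha>\<close>, Sturmian for irrational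
  \<open>\<alpha>\<close>; \<open>nat\<close> loses nothing for positive \<open>\<alpha>\<close>,
  where the difference is nonnegative.\<close>

definition slope_word :: "real \<Rightarrow> nat \<Rightarrow> nat" where
  "slope_word \<alpha> k = nat (\<lfloor>real (Suc k) * \<alpha>\<rfloor> - \<lfloor>real k * \<alpha>\<rfloor>)"

text \<open>The letters \<open>n - 1\<close> down to \<open>1\<close> are read backwards; letter
  \<open>0\<close> is outside, and \<open>s\<close> stands in its place.\<close>

definition left_value :: "real \<Rightarrow> real \<Rightarrow> nat \<Rightarrow> real" where
  "left_value \<alpha> s n = word_map (n - 1) (\<lambda>j. slope_word \<alpha> (n - 1 - j)) s"

text \<open>At such \<open>N\<close> the distance from \<open>N * \<alpha>\<close> to the nearest integer is smaller than for all
  earlier multiples, and the nearest integer lies above.\<close>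

definition upper_record :: "real \<Rightarrow> nat \<Rightarrow> bool" where
  "upper_record \<alpha> N \<longleftrightarrow> N \<ge> 2 \<and>
    (\<forall>j\<in>{1..<N}. 1 - frac (real N * \<alpha>) < frac (real j * \<alpha>) \<and> frac (real j * \<alpha>) < frac (real N * \<alpha>))"

context
  fixes \<alpha> :: real
  assumes \<alpha>: "0 < \<alpha>" "\<alpha> < 1"
begin

abbreviation "sw \<equiv> slope_word \<alpha>"

lemma int_slope_word: "int (sw k) = \<lfloor>real (Suc k) * \<alpha>\<rfloor> - \<lfloor>real k * \<alpha>\<rfloor>"
  using \<alpha> unfolding slope_word_def by (simp add: floor_mono)

lemma slope_word_le: "sw k \<le> 1"
proof -
  have "real (Suc k) * \<alpha> < real k * \<alpha> + 1" using \<alpha> by (simp add: algebra_simps)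
  then have "\<lfloor>real (Suc k) * \<alpha>\<rfloor> \<le> \<lfloor>real k * \<alpha> + 1\<rfloor>" by (intro floor_mono) simp
  then have "int (sw k) \<le> 1" unfolding int_slope_word by simp
  then show ?thesis by simp
qed

lemma slope_word_0: "sw 0 = 0"
  using \<alpha> by (simp add: slope_word_def floor_eq_iff)

section \<open>Partial sums and comparison at the factors 01 and 10\<close>

lemma sum_slope_word: "int (\<Sum>j<k. sw (n + j)) = \<lfloor>real (n + k) * \<alpha>\<rfloor> - \<lfloor>real n * \<alpha>\<rfloor>"
proof (induction k)
  case (Suc k)
  then show ?case using int_slope_word[of "n + k"] by (simp del: of_nat_Suc)
qed simp

lemma sum_slope_word_rev:
  "k \<le> n \<Longrightarrow> int (\<Sum>j<k. sw (n - 1 - j)) = \<lfloor>real n * \<alpha>\<rfloor> - \<lfloor>real (n - k) * \<alpha>\<rfloor>"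
proof (induction k)
  case (Suc k)
  define m where "m = n - 1 - k"
  have nk: "n - k = Suc m" "n - Suc k = m" using Suc.prems by (auto simp: m_def)
  have "int (\<Sum>j<k. sw (n - 1 - j)) = \<lfloor>real n * \<alpha>\<rfloor> - \<lfloor>real (Suc m) * \<alpha>\<rfloor>"
    using Suc by (simp add: nk del: of_nat_Suc)
  then show ?case
    using int_slope_word[of m] by (simp add: nk flip: m_def del: of_nat_Suc)
qed simp

text \<open>Index \<open>Suc n\<close>, between the two letters, is a centre of symmetry: the sums
  after and before the factor involve \<open>\<lfloor>N + y\<rfloor>\<close> and
  \<open>\<lfloor>N - y\<rfloor>\<close>. Their total is at most \<open>2 * N\<close>, hence at most
  \<open>2 * \<lfloor>N\<rfloor> + 1\<close>.\<close>

lemma slope_sums_01: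
  assumes "sw n = 0" "sw (Suc n) = 1" "k \<le> n"
  shows "(\<Sum>j<k. sw (n + 2 + j)) \<le> (\<Sum>j<k. sw (n - 1 - j))"
proof -
  define N where "N = real (Suc n) * \<alpha>"
  define y where "y = real (Suc k) * \<alpha>"
  have 1: "\<lfloor>real n * \<alpha>\<rfloor> = \<lfloor>N\<rfloor>" "\<lfloor>real (n + 2) * \<alpha>\<rfloor> = \<lfloor>N\<rfloor> + 1"
    using int_slope_word[of n] int_slope_word[of "Suc n"] assms by (simp_all add: N_def)
  have 2: "real (n + 2 + k) * \<alpha> = N + y" "real (n - k) * \<alpha> = N - y"
    using assms(3) by (simp_all add: N_def y_def of_nat_diff algebra_simps)
  have "\<lfloor>N + y\<rfloor> + \<lfloor>N - y\<rfloor> \<le> 2 * N"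
    using of_int_floor_le[of "N + y"] of_int_floor_le[of "N - y"] by linarith
  moreover have "2 * N < 2 * \<lfloor>N\<rfloor> + 2" by linarith
  ultimately have "\<lfloor>N + y\<rfloor> + \<lfloor>N - y\<rfloor> \<le> 2 * \<lfloor>N\<rfloor> + 1" by linarith
  then have "int (\<Sum>j<k. sw (n + 2 + j)) \<le> int (\<Sum>j<k. sw (n - 1 - j))"
    unfolding sum_slope_word sum_slope_word_rev[OF assms(3)] 1 2 by simp
  then show ?thesis by linarith
qed

text \<open>Around the same centre, rounding down loses less than \<open>2\<close> in total, so the
  two floors add up to at least \<open>2 * \<lfloor>N\<rfloor> - 1\<close>.\<close>

lemma slope_sums_10:
  assumes "sw n = 1" "sw (Suc n) = 0" "k \<le> n"
  shows "(\<Sum>j<k. sw (n - 1 - j)) \<le> (\<Sum>j<k. sw (n + 2 + j))"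
proof -
  define N where "N = real (Suc n) * \<alpha>"
  define y where "y = real (Suc k) * \<alpha>"
  have 1: "\<lfloor>real n * \<alpha>\<rfloor> = \<lfloor>N\<rfloor> - 1" "\<lfloor>real (n + 2) * \<alpha>\<rfloor> = \<lfloor>N\<rfloor>"
    using int_slope_word[of n] int_slope_word[of "Suc n"] assms by (simp_all add: N_def)
  have 2: "real (n + 2 + k) * \<alpha> = N + y" "real (n - k) * \<alpha> = N - y"
    using assms(3) by (simp_all add: N_def y_def of_nat_diff algebra_simps)
  have "2 * N < \<lfloor>N + y\<rfloor> + \<lfloor>N - y\<rfloor> + 2" by linarith
  moreover have "2 * N \<ge> 2 * \<lfloor>N\<rfloor>" by linarith
  ultimately have "2 * \<lfloor>N\<rfloor> \<le> \<lfloor>N + y\<rfloor> + \<lfloor>N - y\<rfloor> + 1" by linarith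
  then have "int (\<Sum>j<k. sw (n - 1 - j)) \<le> int (\<Sum>j<k. sw (n + 2 + j))"
    unfolding sum_slope_word sum_slope_word_rev[OF assms(3)] 1 2 by simp
  then show ?thesis by linarith
qed

text \<open>For \<open>k = n\<close> the left end is \<open>N - y = 0\<close>, where rounding loses
  nothing; this gains the strict inequality.\<close>

lemma slope_sum_10_full:
  assumes "sw n = 1" "sw (Suc n) = 0"
  shows "(\<Sum>j<n. sw (n - 1 - j)) < (\<Sum>j<n. sw (n + 2 + j))"
proof -
  define N where "N = real (Suc n) * \<alpha>"
  have 1: "\<lfloor>real n * \<alpha>\<rfloor> = \<lfloor>N\<rfloor> - 1" "\<lfloor>real (n + 2) * \<alpha>\<rfloor> = \<lfloor>N\<rfloor>"
    using int_slope_word[of n] int_slope_word[of "Suc n"] assms by (simp_all add: N_def)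
  have 2: "real (n + 2 + n) * \<alpha> = 2 * N"
    by (simp add: N_def algebra_simps)
  have "2 * \<lfloor>N\<rfloor> \<le> \<lfloor>2 * N\<rfloor>" by linarith
  then have "int (\<Sum>j<n. sw (n - 1 - j)) < int (\<Sum>j<n. sw (n + 2 + j))"
    unfolding sum_slope_word sum_slope_word_rev[OF order_refl] 1 2 by simp
  then show ?thesis by linarith
qed

lemma left_value_1: "left_value \<alpha> s (Suc 0) = s"
  by (simp add: left_value_def)

lemma left_value_Suc:
  assumes "n \<ge> 1"
  shows "left_value \<alpha> s (Suc n) = letter_map (sw n) (left_value \<alpha> s n)"
proof -
  obtain m where "n = Suc m" using assms by (cases n) auto
  then show ?thesis by (simp add: left_value_def)
qed

lemma left_value_bounds:
  assumes "0 \<le> s" "s \<le> 1"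
  shows "0 \<le> left_value \<alpha> s n" "left_value \<alpha> s n \<le> 1"
  unfolding left_value_def using word_map_bounds[OF assms] by blast+

lemma sw_cases: "sw k = 0 \<or> sw k = 1"
  using slope_word_le[of k] by linarith

text \<open>\<open>slope_sums_01\<close> also holds for \<open>k = n\<close>, where the reversed prefix runs into
  \<open>slope_word \<alpha> 0 = 0\<close>, a letter outside of the word.  This is what yields the last conjunct.\<close>

lemma compare_01:
  assumes "n \<ge> 1" "sw n = 0" "sw (Suc n) = 1"
  shows "(\<forall>s. 0 \<le> s \<longrightarrow> s \<le> 1 \<longrightarrow> word_tail sw (n + 2) < left_value \<alpha> s n) \<or>
    (\<forall>j<n - 1. sw (n + 2 + j) = sw (n - 1 - j)) \<and> sw (2 * n + 1) = 0"
proof (cases "\<exists>j<n - 1. sw (n + 2 + j) \<noteq> sw (n - 1 - j)")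
  case True
  then obtain j where j: "j < n - 1" "sw (n + 2 + j) \<noteq> sw (n - 1 - j)" by blast
  have "word_tail sw (n + 2) < left_value \<alpha> s n" if "0 \<le> s" "s \<le> 1" for s
    unfolding left_value_def word_tail_shift[of sw "n + 2" "n - 1"]
  proof (rule word_map_less[where j = j])
    fix k assume "k \<le> n - 1"
    then have "k \<le> n" by simp
    from slope_sums_01[OF assms(2,3) this]
    show "(\<Sum>j<k. sw (n + 2 + j)) \<le> (\<Sum>j<k. sw (n - 1 - j))" .
  qed (use j that word_tail_bounds_weak slope_word_le in blast)+
  then show ?thesis by blast
next
  case False
  then have eq: "sw (n + 2 + j) = sw (n - 1 - j)" if "j < n - 1" for j using that by blast
  obtain m where m: "n = Suc m" using assms(1) by (cases n) auto
  have "(\<Sum>j<m. sw (n + 2 + j)) = (\<Sum>j<m. sw (n - 1 - j))"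
    by (intro sum.cong) (use eq m in simp_all)
  moreover have "(\<Sum>j<Suc m. sw (n + 2 + j)) \<le> (\<Sum>j<Suc m. sw (n - 1 - j))"
    using slope_sums_01[OF assms(2,3), of "Suc m"] m by simp
  ultimately have "sw (n + 2 + m) \<le> sw (n - 1 - m)" by simp
  then have "sw (2 * n + 1) = 0" using m slope_word_0 by (simp add: mult_2)
  then show ?thesis using eq by blast
qed

text \<open>If the reversed prefix agrees throughout with what follows,
  \<open>slope_sum_10_full\<close> forces the next letter on the right to be \<open>1\<close>. Its
  value exceeds \<open>1 / 2\<close> and hence the seed.\<close>

lemma compare_10:
  assumes "n \<ge> 1" "sw n = 1" "sw (Suc n) = 0" "0 \<le> s" "s \<le> 1 / 2"
  shows "left_value \<alpha> s n < word_tail sw (n + 2)"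
proof (cases "\<exists>j<n - 1. sw (n + 2 + j) \<noteq> sw (n - 1 - j)")
  case True
  then obtain j where j: "j < n - 1" "sw (n - 1 - j) \<noteq> sw (n + 2 + j)" by metis
  show ?thesis
    unfolding left_value_def word_tail_shift[of sw "n + 2" "n - 1"]
  proof (rule word_map_less[where j = j])
    fix k assume "k \<le> n - 1"
    then have "k \<le> n" by simp
    from slope_sums_10[OF assms(2,3) this]
    show "(\<Sum>j<k. sw (n - 1 - j)) \<le> (\<Sum>j<k. sw (n + 2 + j))" .
  next
    show "s \<le> 1" using assms(5) by simp
  qed (use j assms(4) word_tail_bounds_weak slope_word_le in blast)+
next
  case False
  then have eq: "sw (n + 2 + j) = sw (n - 1 - j)" if "j < n - 1" for j using that by blast
  obtain m where m: "n = Suc m" using assms(1) by (cases n) auto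
  have "(\<Sum>j<m. sw (n + 2 + j)) = (\<Sum>j<m. sw (n - 1 - j))"
    by (intro sum.cong) (use eq m in simp_all)
  moreover have "(\<Sum>j<Suc m. sw (n - 1 - j)) < (\<Sum>j<Suc m. sw (n + 2 + j))"
    using slope_sum_10_full[OF assms(2,3)] m by simp
  ultimately have "sw (n + 2 + m) > sw (n - 1 - m)" by simp
  then have 1: "sw (n + 2 + m) = Suc 0" using slope_word_le[of "n + 2 + m"] by simp
  have "s < word_tail sw (n + 2 + m)"
  proof -
    have "1 / 2 < word_tail sw (n + 2 + m)"
      unfolding word_tail_Suc[of sw "n + 2 + m"] 1
      using word_tail_bounds[where w = sw and k = "Suc (n + 2 + m)"]
      by (intro letter_map_1_bounds(3)) auto
    then show ?thesis using assms(5) by linarith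
  qed
  then have "word_map m (\<lambda>j. sw (n - 1 - j)) s < word_map m (\<lambda>j. sw (n - 1 - j)) (word_tail sw (n + 2 + m))"
    using assms(4) word_tail_bounds_weak by (intro word_map_strict_mono) auto
  also have "\<dots> = word_map m (\<lambda>j. sw (n + 2 + j)) (word_tail sw (n + 2 + m))"
    by (rule word_map_cong) (use eq m in simp)
  finally have "word_map m (\<lambda>j. sw (n - 1 - j)) s < word_tail sw (n + 2)"
    by (simp only: word_tail_shift[of sw "n + 2" m])
  moreover have "left_value \<alpha> s n = word_map m (\<lambda>j. sw (n - 1 - j)) s"
    unfolding left_value_def by (simp only: m diff_Suc_1)
  ultimately show ?thesis by (simp only:)
qed

text \<open>In the exceptional case of \<open>compare_01\<close> the next letter on the right is
  \<open>0\<close>, so its tail is below \<open>3 / 7\<close> and thus below the seed.\<close>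

lemma compare_01_strict:
  assumes "n \<ge> 1" "sw n = 0" "sw (Suc n) = 1" "3 / 7 \<le> s" "s \<le> 1"
  shows "word_tail sw (n + 2) < left_value \<alpha> s n"
  using compare_01[OF assms(1-3)]
proof
  assume *: "(\<forall>j<n - 1. sw (n + 2 + j) = sw (n - 1 - j)) \<and> sw (2 * n + 1) = 0"
  have e: "n + 2 + (n - 1) = 2 * n + 1" using assms(1) by simp
  have "word_tail sw (n + 2) = word_map (n - 1) (\<lambda>j. sw (n + 2 + j)) (word_tail sw (2 * n + 1))"
    by (rule word_tail_shift[of sw "n + 2" "n - 1", unfolded e])
  also have "\<dots> = word_map (n - 1) (\<lambda>j. sw (n - 1 - j)) (word_tail sw (2 * n + 1))"
    by (rule word_map_cong) (use * in blast)
  also have "\<dots> < left_value \<alpha> s n"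
    unfolding left_value_def
  proof (rule word_map_strict_mono)
    have "word_tail sw (2 * n + 1) < 3 / 7"
      unfolding word_tail_Suc[of sw "2 * n + 1"] conjunct2[OF *]
      using word_tail_bounds[where w = sw and k = "Suc (2 * n + 1)"] by (intro letter_map_0_bounds(3)) auto
    then show "word_tail sw (2 * n + 1) < s" using assms(4) by linarith
  qed (use assms(5) word_tail_bounds_weak in blast)+
  finally show ?thesis .
next
  assume "\<forall>s. 0 \<le> s \<longrightarrow> s \<le> 1 \<longrightarrow> word_tail sw (n + 2) < left_value \<alpha> s n"
  moreover have "0 \<le> s" using assms(4) by linarith
  ultimately show ?thesis using assms(5) by blast
qed

text \<open>Both sides carry the same \<open>n - 1\<close> letters with different seeds, and each
  letter contracts by a factor of at least \<open>4\<close>.\<close>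

lemma compare_01_close:
  assumes "\<forall>j<n - 1. sw (n + 2 + j) = sw (n - 1 - j)" "0 \<le> s" "s \<le> 1"
  shows "\<bar>word_tail sw (n + 2) - left_value \<alpha> s n\<bar> \<le> (1 / 4) ^ (n - 1)"
proof -
  have "word_tail sw (n + 2) = word_map (n - 1) (\<lambda>j. sw (n - 1 - j)) (word_tail sw (n + 2 + (n - 1)))"
    unfolding word_tail_shift[of sw "n + 2" "n - 1"] by (rule word_map_cong) (use assms in blast)
  then show ?thesis
    by (simp only: left_value_def word_map_lipschitz word_tail_bounds_weak assms(2,3))
qed

lemma compare_01_zero:
  assumes "\<forall>j<n - 1. sw (n + 2 + j) = sw (n - 1 - j)"
  shows "left_value \<alpha> 0 n < word_tail sw (n + 2)"
proof -
  have "word_tail sw (n + 2) = word_map (n - 1) (\<lambda>j. sw (n - 1 - j)) (word_tail sw (n + 2 + (n - 1)))"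
    unfolding word_tail_shift[of sw "n + 2" "n - 1"] by (rule word_map_cong) (use assms in blast)
  moreover have "0 < word_tail sw (n + 2 + (n - 1))"
    using word_tail_bounds(1)[of sw "n + 2 + (n - 1)"] by linarith
  ultimately show ?thesis
    by (simp only: left_value_def word_map_strict_mono word_tail_bounds_weak order_refl)
qed

text \<open>For the earlier multiples \<open>y\<close>, the record says that adding \<open>y\<close>
  to \<open>N\<close> carries into the next integer while subtracting it does not borrow. So
  \<open>slope_sums_01\<close> holds with equality for all \<open>k \<le> n - 1\<close>, and the
  letters agree one by one.\<close>

lemma upper_record_palindrome:
  assumes "upper_record \<alpha> (Suc n)"
  shows "n \<ge> 1" "sw n = 0" "sw (Suc n) = 1" "\<forall>j<n - 1. sw (n + 2 + j) = sw (n - 1 - j)"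
proof -
  define N where "N = real (Suc n) * \<alpha>"
  show n: "n \<ge> 1" using assms by (simp add: upper_record_def)
  have N: "real n * \<alpha> = N - \<alpha>" "real (n + 2) * \<alpha> = N + \<alpha>" "real (Suc (Suc n)) * \<alpha> = N + \<alpha>"
    by (simp_all add: N_def algebra_simps)
  have rec: "1 - frac N < frac (real j * \<alpha>)" "frac (real j * \<alpha>) < frac N" if "1 \<le> j" "j \<le> n" for j
    using assms that unfolding upper_record_def N_def by auto
  have "frac \<alpha> = \<alpha>" using \<alpha> by (simp add: frac_eq)
  \<comment> \<open>The multiple \<open>j = 1\<close> yields the factor 01 itself.\<close>
  then have a: "1 - frac N < \<alpha>" "\<alpha> < frac N" using rec[of 1] n by auto
  have fl: "\<lfloor>N - \<alpha>\<rfloor> = \<lfloor>N\<rfloor>" "\<lfloor>N + \<alpha>\<rfloor> = \<lfloor>N\<rfloor> + 1"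
    using a \<alpha> unfolding frac_def by linarith+
  have "int (sw n) = 0" "int (sw (Suc n)) = 1"
    unfolding int_slope_word N N_def[symmetric] fl by auto
  then show "sw n = 0" "sw (Suc n) = 1" by auto
  have sums: "(\<Sum>j<k. sw (n + 2 + j)) = (\<Sum>j<k. sw (n - 1 - j))" if "k \<le> n - 1" for k
  proof -
    define y where "y = real (Suc k) * \<alpha>"
    have k: "k \<le> n" "1 \<le> Suc k" "Suc k \<le> n" using that n by auto
    have 2: "real (n + 2 + k) * \<alpha> = N + y" "real (n - k) * \<alpha> = N - y"
      using k by (simp_all add: N_def y_def of_nat_diff algebra_simps)
    have y: "1 - frac N < frac y" "frac y < frac N" using rec[OF k(2,3)] unfolding y_def by auto
    have "\<lfloor>N + y\<rfloor> = \<lfloor>N\<rfloor> + \<lfloor>y\<rfloor> + 1" "\<lfloor>N - y\<rfloor> = \<lfloor>N\<rfloor> - \<lfloor>y\<rfloor>"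
      using y unfolding frac_def by linarith+
    then have "int (\<Sum>j<k. sw (n + 2 + j)) = int (\<Sum>j<k. sw (n - 1 - j))"
      unfolding sum_slope_word sum_slope_word_rev[OF k(1)] 2 N fl by simp
    then show ?thesis by linarith
  qed
  show "\<forall>j<n - 1. sw (n + 2 + j) = sw (n - 1 - j)"
  proof (intro allI impI)
    fix j assume "j < n - 1"
    then have "Suc j \<le> n - 1" "j \<le> n - 1" by auto
    from sums[OF this(1)] sums[OF this(2)] show "sw (n + 2 + j) = sw (n - 1 - j)"
      by (simp only: sum.lessThan_Suc add_left_cancel)
  qed
qed

end

section \<open>Continued fractions of slope words\<close>

text \<open>The partial sums give \<open>\<lfloor>k * \<alpha>\<rfloor>\<close>, while
  \<open>k * \<alpha>\<close> and \<open>k * \<beta>\<close> drift more than \<open>1\<close> apart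
  for large \<open>k\<close>.\<close>

lemma slope_word_inj:
  assumes "0 < \<alpha>" "\<alpha> < 1" "0 < \<beta>" "\<beta> < 1" "\<And>k. slope_word \<alpha> k = slope_word \<beta> k"
  shows "\<alpha> = \<beta>"
proof (rule ccontr)
  assume "\<alpha> \<noteq> \<beta>"
  then obtain k :: nat where "1 / \<bar>\<alpha> - \<beta>\<bar> < k" using reals_Archimedean2 by blast
  then have k: "1 < \<bar>real k * \<alpha> - real k * \<beta>\<bar>"
    using \<open>\<alpha> \<noteq> \<beta>\<close> by (simp add: pos_divide_less_eq abs_mult flip: right_diff_distrib)
  have "\<lfloor>real k * \<alpha>\<rfloor> = \<lfloor>real k * \<beta>\<rfloor>"
    using sum_slope_word[OF assms(1,2), of 0 k] sum_slope_word[OF assms(3,4), of 0 k] assms(5) by simp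
  then show False using k by linarith
qed

definition letter_digit :: "nat \<Rightarrow> nat" where
  "letter_digit a = (if a = 0 then 2 else 1)"

text \<open>The blocks start with letter \<open>1\<close>, and each letter yields two equal partial
  quotients.\<close>

definition word_digits :: "(nat \<Rightarrow> nat) \<Rightarrow> nat \<Rightarrow> nat" where
  "word_digits w i = letter_digit (w (Suc (i div 2)))"

definition word_cf_tail :: "(nat \<Rightarrow> nat) \<Rightarrow> nat \<Rightarrow> real" where
  "word_cf_tail w i =
    (if even i then word_tail w (Suc (i div 2))
     else 1 / (letter_digit (w (Suc (i div 2))) + word_tail w (Suc (Suc (i div 2)))))"

lemma letter_map_digit:
  fixes s :: real
  shows "letter_map a s = 1 / (letter_digit a + 1 / (letter_digit a + s))"
  by (simp add: letter_map_def letter_digit_def)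

lemma cf_tails_word: "cf_tails (word_digits w) (word_cf_tail w)"
  unfolding cf_tails_def
proof
  fix i
  define k where "k = Suc (i div 2)"
  let ?D = "real (letter_digit (w k))"
  have D: "?D \<ge> 1" by (simp add: letter_digit_def)
  have s: "word_tail w (Suc k) > 0" using word_tail_bounds(1)[of w "Suc k"] by linarith
  have p: "?D + word_tail w (Suc k) > 1" using D s by linarith
  have q: "?D + 1 / (?D + word_tail w (Suc k)) > 0" using D p by (simp add: add_pos_pos)
  have t: "word_tail w k = 1 / (?D + 1 / (?D + word_tail w (Suc k)))"
    using word_tail_Suc letter_map_digit by metis
  have d: "word_digits w i = letter_digit (w k)" by (simp add: word_digits_def k_def)
  show "1 \<le> word_digits w i \<and> 0 < word_cf_tail w i \<and> word_cf_tail w i < 1 \<and>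
      word_cf_tail w i * (real (word_digits w i) + word_cf_tail w (Suc i)) = 1"
  proof (cases "even i")
    case True
    then have "word_cf_tail w i = word_tail w k" "word_cf_tail w (Suc i) = 1 / (?D + word_tail w (Suc k))"
      by (simp_all add: word_cf_tail_def k_def)
    moreover have "0 < word_tail w k" "word_tail w k < 1"
      using word_tail_bounds[of w k] by linarith+
    moreover have "word_tail w k * (?D + 1 / (?D + word_tail w (Suc k))) = 1"
      unfolding t using q by simp
    ultimately show ?thesis using D d by simp
  next
    case False
    then have "word_cf_tail w i = 1 / (?D + word_tail w (Suc k))" "word_cf_tail w (Suc i) = word_tail w (Suc k)"
      by (simp_all add: word_cf_tail_def k_def)
    then show ?thesis using D d p by simp
  qed
qed

text \<open>The identity \<open>[0; 2, X] + [0; 1, 1, X] = 1\<close>. It turns the constant at a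
  digit \<open>2\<close> into \<open>3\<close> plus a difference of two values.\<close>

lemma digit_shift:
  assumes "s \<ge> 0"
  shows "2 + 1 / (2 + s) = 3 - letter_map (Suc 0) s"
  using assms by (simp add: letter_map_eq field_simps)

section \<open>Approximation constants of a word behind \<open>m\<close> further digits\<close>

context
  fixes \<alpha> :: real and d :: "nat \<Rightarrow> nat" and t :: "nat \<Rightarrow> real" and m :: nat
  assumes \<alpha>: "0 < \<alpha>" "\<alpha> < 1"
    and cf: "cf_tails d t"
    and d: "\<And>i. d (m + i) = word_digits (slope_word \<alpha>) i"
    and t: "\<And>i. t (m + i) = word_cf_tail (slope_word \<alpha>) i"
    and left: "cf_left d m \<le> 1 / 2"
begin

abbreviation "left_at \<equiv> left_value \<alpha> (cf_left d m)"

lemma left_m: "0 \<le> cf_left d m" "cf_left d m \<le> 1"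
  using cf_left_bounds[OF cf] by blast+

lemma left_at_bounds: "0 \<le> left_at n" "left_at n \<le> 1"
  by (rule left_value_bounds[OF \<alpha> left_m])+

lemma cf_left_word: "cf_left d (m + 2 * k) = left_at (Suc k)"
proof (induction k)
  case 0
  then show ?case by (simp add: left_value_1[OF \<alpha>])
next
  case (Suc k)
  have "d (m + 2 * k) = letter_digit (sw \<alpha> (Suc k))" "d (Suc (m + 2 * k)) = letter_digit (sw \<alpha> (Suc k))"
    using d[of "2 * k"] d[of "Suc (2 * k)"] by (simp_all add: word_digits_def)
  then show ?case
    using Suc left_value_Suc[OF \<alpha>, of "Suc k" "cf_left d m"] by (simp add: letter_map_digit)
qed

lemma cf_const_word:
  fixes k :: nat
  defines "D \<equiv> real (letter_digit (sw \<alpha> (Suc k)))"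
  shows "cf_const d t (m + 2 * k) = D + 1 / (D + word_tail (sw \<alpha>) (k + 2)) + left_at (Suc k)"
    and "cf_const d t (m + (2 * k + 1)) = D + word_tail (sw \<alpha>) (k + 2) + 1 / (D + left_at (Suc k))"
proof -
  have "d (m + 2 * k) = letter_digit (sw \<alpha> (Suc k))" "d (Suc (m + 2 * k)) = letter_digit (sw \<alpha> (Suc k))"
    using d[of "2 * k"] d[of "Suc (2 * k)"] by (simp_all add: word_digits_def)
  moreover have "t (Suc (m + 2 * k)) = 1 / (D + word_tail (sw \<alpha>) (k + 2))"
    "t (Suc (Suc (m + 2 * k))) = word_tail (sw \<alpha>) (k + 2)"
    using t[of "Suc (2 * k)"] t[of "2 * k + 2"] by (simp_all add: word_cf_tail_def D_def)
  ultimately show "cf_const d t (m + 2 * k) = D + 1 / (D + word_tail (sw \<alpha>) (k + 2)) + left_at (Suc k)"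
    "cf_const d t (m + (2 * k + 1)) = D + word_tail (sw \<alpha>) (k + 2) + 1 / (D + left_at (Suc k))"
    using cf_left_word[of k] by (simp_all add: cf_const_def D_def)
qed

text \<open>A digit \<open>1\<close> contributes \<open>1\<close>, and each of its two sides at most
  \<open>1\<close>.\<close>

lemma cf_const_word_1:
  assumes "sw \<alpha> (Suc k) \<noteq> 0"
  shows "cf_const d t (m + 2 * k) \<le> 3" "cf_const d t (m + (2 * k + 1)) \<le> 3"
proof -
  have D: "real (letter_digit (sw \<alpha> (Suc k))) = 1" using assms by (simp add: letter_digit_def)
  have s: "0 < word_tail (sw \<alpha>) (k + 2)" "word_tail (sw \<alpha>) (k + 2) \<le> 1"
    using word_tail_bounds[of "sw \<alpha>" "k + 2"] by linarith+
  have "1 / (1 + word_tail (sw \<alpha>) (k + 2)) \<le> 1" "1 / (1 + left_at (Suc k)) \<le> 1"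
    using s left_at_bounds[of "Suc k"] by simp_all
  then show "cf_const d t (m + 2 * k) \<le> 3" "cf_const d t (m + (2 * k + 1)) \<le> 3"
    unfolding cf_const_word D using s left_at_bounds[of "Suc k"] by linarith+
qed

lemma cf_const_word_0:
  assumes "sw \<alpha> (Suc k) = 0"
  shows "cf_const d t (m + 2 * k) = 3 + left_at (Suc k) - letter_map (Suc 0) (word_tail (sw \<alpha>) (k + 2))"
    "cf_const d t (m + (2 * k + 1)) = 3 + word_tail (sw \<alpha>) (k + 2) - letter_map (Suc 0) (left_at (Suc k))"
  unfolding cf_const_word assms
  using digit_shift[OF word_tail_bounds_weak(1)[of "sw \<alpha>" "k + 2"]] digit_shift[OF left_at_bounds(1)[of "Suc k"]]
  by (simp_all add: letter_digit_def)

text \<open>At the first digit of a block \<open>2, 2\<close> the preceding letter decides: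
  \<open>0\<close> leaves at most \<open>3 / 7 < 1 / 2\<close> on the left, and \<open>1\<close>
  makes a factor 10, covered by \<open>compare_10\<close>. In front of the first block the seed is
  at most \<open>1 / 2\<close>.\<close>

lemma cf_const_word_even: "cf_const d t (m + 2 * k) \<le> 3"
proof (cases "sw \<alpha> (Suc k) = 0")
  case True
  let ?s = "word_tail (sw \<alpha>) (k + 2)"
  have s: "0 \<le> ?s" "?s \<le> 1" by (rule word_tail_bounds_weak)+
  have "left_at (Suc k) \<le> letter_map (Suc 0) ?s"
  proof (cases k)
    case 0
    then show ?thesis
      using letter_map_1_bounds(1)[OF s] left by (simp add: left_value_1[OF \<alpha>])
  next
    case (Suc n)
    have L: "left_at (Suc k) = letter_map (sw \<alpha> k) (left_at k)"
      using left_value_Suc[OF \<alpha>, of k] Suc by simp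
    consider "sw \<alpha> k = 0" | "sw \<alpha> k = 1" using sw_cases[OF \<alpha>, of k] by metis
    then show ?thesis
    proof cases
      case 1
      then show ?thesis
        using letter_map_0_bounds(2)[OF left_at_bounds[of k]] letter_map_1_bounds(1)[OF s] L by simp
    next
      case 2
      have "left_at k < ?s"
        using compare_10[OF \<alpha> _ 2 True left_m(1) left] Suc by simp
      then show ?thesis using letter_map_diff(1)[OF left_at_bounds(1)] L 2 by simp
    qed
  qed
  then show ?thesis by (simp add: cf_const_word_0 True)
qed (use cf_const_word_1 in blast)

lemma cf_const_word_01:
  assumes "sw \<alpha> (Suc k) = 0" "sw \<alpha> (Suc (Suc k)) = 1"
  shows "cf_const d t (m + (2 * k + 1)) =
    3 + letter_map (Suc 0) (word_tail (sw \<alpha>) (Suc k + 2)) - letter_map (Suc 0) (left_at (Suc k))"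
  using cf_const_word_0(2)[OF assms(1)] word_tail_Suc[of "sw \<alpha>" "k + 2"] assms(2) by simp

text \<open>At the second digit of a block \<open>2, 2\<close>, a following letter \<open>0\<close>
  keeps the tail at most \<open>3 / 7\<close>, below the \<open>1 / 2\<close> on the other side.
  Hence only a factor 01 can exceed \<open>3\<close>.\<close>

lemma cf_const_word_odd:
  assumes "sw \<alpha> (Suc k) \<noteq> 0 \<or> sw \<alpha> (Suc (Suc k)) \<noteq> 1 \<or> word_tail (sw \<alpha>) (Suc k + 2) \<le> left_at (Suc k)"
  shows "cf_const d t (m + (2 * k + 1)) \<le> 3"
proof (cases "sw \<alpha> (Suc k) = 0")
  case True
  show ?thesis
  proof (cases "sw \<alpha> (Suc (Suc k)) = 1")
    case T: True
    then have "word_tail (sw \<alpha>) (Suc k + 2) \<le> left_at (Suc k)" using assms True by blast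
    then show ?thesis
      unfolding cf_const_word_01[OF True T]
      using letter_map_diff(1)[OF word_tail_bounds_weak(1)] by (simp only: diff_le_eq add_left_mono)
  next
    case False
    then have "sw \<alpha> (k + 2) = 0" using sw_cases[OF \<alpha>, of "k + 2"] by simp
    then have "word_tail (sw \<alpha>) (k + 2) \<le> 3 / 7"
      using word_tail_Suc[of "sw \<alpha>" "k + 2"] letter_map_0_bounds(2)[OF word_tail_bounds_weak] by metis
    then show ?thesis
      unfolding cf_const_word_0(2)[OF True]
      using letter_map_1_bounds(1)[OF left_at_bounds[of "Suc k"]] by linarith
  qed
qed (use cf_const_word_1 in blast)

lemma cf_const_palindrome:
  assumes "sw \<alpha> (Suc k) = 0" "sw \<alpha> (Suc (Suc k)) = 1"
    "\<forall>j<k. sw \<alpha> (Suc k + 2 + j) = sw \<alpha> (k - j)"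
  shows "\<bar>cf_const d t (m + (2 * k + 1)) - 3\<bar> \<le> (1 / 4) ^ k"
proof -
  let ?s = "word_tail (sw \<alpha>) (Suc k + 2)"
  have "\<bar>cf_const d t (m + (2 * k + 1)) - 3\<bar> = \<bar>letter_map (Suc 0) ?s - letter_map (Suc 0) (left_at (Suc k))\<bar>"
    unfolding cf_const_word_01[OF assms(1,2)] by simp
  also have "\<dots> \<le> \<bar>?s - left_at (Suc k)\<bar> / 4"
    by (rule letter_map_lipschitz[OF word_tail_bounds_weak(1) left_at_bounds(1)])
  also have "\<dots> \<le> \<bar>?s - left_at (Suc k)\<bar>" by simp
  also have "\<dots> \<le> (1 / 4) ^ k"
    using compare_01_close[OF \<alpha> _ left_m, of "Suc k"] assms(3) by simp
  finally show ?thesis .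
qed

lemma upper_record_const:
  assumes "upper_record \<alpha> (Suc (Suc k))"
  shows "sw \<alpha> (Suc k) = 0" "sw \<alpha> (Suc (Suc k)) = 1" "\<forall>j<k. sw \<alpha> (Suc k + 2 + j) = sw \<alpha> (k - j)"
  using upper_record_palindrome[OF \<alpha> assms] by simp_all

lemma upper_record_unbounded:
  assumes "infinite {N. upper_record \<alpha> N}"
  obtains k where "b < k" "upper_record \<alpha> (Suc (Suc k))"
proof -
  obtain N where "N > b + 2" "upper_record \<alpha> N"
    using assms unfolding infinite_nat_iff_unbounded by blast
  then show ?thesis using that[of "N - 2"] by (simp add: Suc_diff_Suc numeral_2_eq_2)
qed

text \<open>Each record gives a palindrome, hence a constant within \<open>(1 / 4) ^ k\<close> of
  \<open>3\<close>.\<close>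

lemma infinite_cf_const_below:
  assumes "infinite {N. upper_record \<alpha> N}" "e > 0"
  shows "infinite {i. 3 - e < cf_const d t i}"
  unfolding infinite_nat_iff_unbounded
proof
  fix b
  obtain r where r: "(1 / 4 :: real) ^ r < e" using real_arch_pow_inv[OF assms(2), of "1/4"] by auto
  obtain k where k: "max b r < k" "upper_record \<alpha> (Suc (Suc k))"
    using upper_record_unbounded[OF assms(1)] .
  have "\<bar>cf_const d t (m + (2 * k + 1)) - 3\<bar> \<le> (1 / 4) ^ k"
    by (rule cf_const_palindrome[OF upper_record_const[OF k(2)]])
  also have "\<dots> \<le> (1 / 4) ^ r" using k(1) by (intro power_decreasing) auto
  finally have "3 - e < cf_const d t (m + (2 * k + 1))" using r by linarith
  then show "\<exists>i>b. i \<in> {i. 3 - e < cf_const d t i}"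
    using k(1) by (intro exI[of _ "m + (2 * k + 1)"]) auto
qed

text \<open>A seed in \<open>[3/7, 1/2]\<close> suits both comparisons: \<open>compare_10\<close> at
  even and \<open>compare_01_strict\<close> at odd positions.\<close>

lemma cf_const_word_le_3:
  assumes "3 / 7 \<le> cf_left d m" "m \<le> i"
  shows "cf_const d t i \<le> 3"
proof -
  have odd: "cf_const d t (m + (2 * k + 1)) \<le> 3" for k
  proof (rule cf_const_word_odd)
    have "word_tail (sw \<alpha>) (Suc k + 2) < left_at (Suc k)" if "sw \<alpha> (Suc k) = 0" "sw \<alpha> (Suc (Suc k)) = 1"
      by (rule compare_01_strict[OF \<alpha> _ that assms(1) left_m(2)]) simp
    then show "sw \<alpha> (Suc k) \<noteq> 0 \<or> sw \<alpha> (Suc (Suc k)) \<noteq> 1 \<or> word_tail (sw \<alpha>) (Suc k + 2) \<le> left_at (Suc k)"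
      by fastforce
  qed
  obtain j where j: "i = m + j" using assms(2) le_Suc_ex by blast
  show ?thesis
  proof (cases "even j")
    case True
    then show ?thesis using j cf_const_word_even by (auto elim!: evenE)
  next
    case False
    then show ?thesis using j odd by (auto elim!: oddE)
  qed
qed

text \<open>The seed \<open>0\<close> lies below every tail, so at each record the palindrome puts
  the left value below the right one.\<close>

lemma infinite_cf_const_gt_3:
  assumes "infinite {N. upper_record \<alpha> N}" "cf_left d m = 0"
  shows "infinite {i. 3 < cf_const d t i}"
  unfolding infinite_nat_iff_unbounded
proof
  fix b
  obtain k where k: "b < k" "upper_record \<alpha> (Suc (Suc k))"
    using upper_record_unbounded[OF assms(1)] .
  note rec = upper_record_const[OF k(2)]
  have "left_at (Suc k) < word_tail (sw \<alpha>) (Suc k + 2)"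
    using compare_01_zero[OF \<alpha>, of "Suc k"] rec(3) assms(2) by simp
  then have "3 < cf_const d t (m + (2 * k + 1))"
    unfolding cf_const_word_01[OF rec(1,2)]
    using letter_map_diff(3)[OF left_at_bounds(1) less_imp_le] by simp
  then show "\<exists>i>b. i \<in> {i. 3 < cf_const d t i}"
    using k(1) by (intro exI[of _ "m + (2 * k + 1)"]) auto
qed

text \<open>Beyond the prefix, a constant above \<open>3\<close> needs the exceptional case of
  \<open>compare_01\<close>; the agreement there brings it within \<open>(1 / 4) ^ k\<close> of
  \<open>3\<close>, so an excess of \<open>e\<close> is possible only for small
  \<open>k\<close>.\<close>

lemma finite_cf_const_above:
  assumes "e > 0"
  shows "finite {i. 3 + e < cf_const d t i}"
proof -
  obtain r where r: "(1 / 4 :: real) ^ r < e" using real_arch_pow_inv[OF assms, of "1/4"] by auto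
  have "i < m + 2 * r" if i: "3 + e < cf_const d t i" for i
  proof (rule ccontr)
    assume "\<not> i < m + 2 * r"
    then obtain j where j: "i = m + j" "2 * r \<le> j" by (metis add_le_cancel_left le_Suc_ex not_less add_leD1)
    show False
    proof (cases "even j")
      case True
      then have "cf_const d t i \<le> 3" using j cf_const_word_even by (auto elim!: evenE)
      then show False using i assms by simp
    next
      case False
      then obtain k where k: "j = 2 * k + 1" by (auto elim!: oddE)
      have n1: "1 \<le> Suc k" by simp
      have C: "\<not> cf_const d t (m + (2 * k + 1)) \<le> 3" using i j k assms by simp
      then have w: "sw \<alpha> (Suc k) = 0" "sw \<alpha> (Suc (Suc k)) = 1" "\<not> word_tail (sw \<alpha>) (Suc k + 2) \<le> left_at (Suc k)"
        using cf_const_word_odd by blast+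
      \<comment> \<open>The actual seed \<open>cf_left d m\<close> is a counterexample.\<close>
      have "\<not> (\<forall>s. 0 \<le> s \<longrightarrow> s \<le> 1 \<longrightarrow> word_tail (sw \<alpha>) (Suc k + 2) < left_value \<alpha> s (Suc k))"
        using w(3) left_m less_imp_le by blast
      then have "\<forall>j<k. sw \<alpha> (Suc k + 2 + j) = sw \<alpha> (k - j)"
        using compare_01[OF \<alpha> n1 w(1,2)] unfolding diff_Suc_1 by blast
      from cf_const_palindrome[OF w(1,2) this]
      have "e < (1 / 4) ^ k" using i j k by simp
      also have "\<dots> \<le> (1 / 4) ^ r" using j k by (intro power_decreasing) auto
      finally show False using r by simp
    qed
  qed
  then have "{i. 3 + e < cf_const d t i} \<subseteq> {..<m + 2 * r}" by blast
  then show ?thesis by (rule finite_subset) simp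
qed

end

section \<open>Partial quotients with a prescribed number of solutions\<close>

definition record_slopes :: "real set" where
  "record_slopes = {\<alpha>. 0 < \<alpha> \<and> \<alpha> < 1 \<and> infinite {N. upper_record \<alpha> N}}"

text \<open>Each \<open>3\<close> contributes one solution.  The \<open>2\<close> in front of the word makes the left value
  lie between those of the words beginning with \<open>2, 2\<close> and those beginning with \<open>1, 1\<close>, so that
  every remaining comparison comes out strict in the direction that excludes a solution; with
  nothing in front, the comparison fails at every record.\<close>

fun X3_digits :: "enat \<Rightarrow> real \<Rightarrow> nat \<Rightarrow> nat" where
  "X3_digits (enat n) \<alpha> = (\<lambda>i. if i < n then 3 else case_nat 2 (word_digits (slope_word \<alpha>)) (i - n))"
| "X3_digits \<infinity> \<alpha> = word_digits (slope_word \<alpha>)"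

lemma X3_digits_inj:
  assumes "X3_digits n \<alpha> = X3_digits n \<beta>" "\<alpha> \<in> record_slopes" "\<beta> \<in> record_slopes"
  shows "\<alpha> = \<beta>"
proof -
  have \<alpha>: "0 < \<alpha>" "\<alpha> < 1" and \<beta>: "0 < \<beta>" "\<beta> < 1" using assms by (auto simp: record_slopes_def)
  have eq: "word_digits (slope_word \<alpha>) i = word_digits (slope_word \<beta>) i" for i
  proof (cases n)
    case (enat m)
    then show ?thesis using fun_cong[OF assms(1), of "Suc m + i"] by (simp add: Suc_diff_le)
  qed (use assms(1) in simp)
  have "slope_word \<alpha> k = slope_word \<beta> k" for k
  proof (cases k)
    \<comment> \<open>The digits do not encode letter \<open>0\<close>, but it is \<open>0\<close>
      for every slope between \<open>0\<close> and \<open>1\<close>.\<close>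
    case 0
    then show ?thesis using slope_word_0 \<alpha> \<beta> by simp
  next
    case (Suc j)
    then show ?thesis
      using eq[of "2 * j"] sw_cases[OF \<alpha>, of k] sw_cases[OF \<beta>, of k]
      by (auto simp: word_digits_def letter_digit_def)
  qed
  then show ?thesis using slope_word_inj[OF \<alpha> \<beta>] by blast
qed

lemma X3_digits_finite:
  assumes "\<alpha> \<in> record_slopes"
  shows "\<exists>t. cf_tails (X3_digits (enat n) \<alpha>) t \<and> t 0 \<in> X3 (enat n)"
proof -
  let ?e = "word_digits (slope_word \<alpha>)" and ?u = "word_cf_tail (slope_word \<alpha>)"
  define d where "d = X3_digits (enat n) \<alpha>"
  have \<alpha>: "0 < \<alpha>" "\<alpha> < 1" and inf: "infinite {N. upper_record \<alpha> N}"
    using assms by (auto simp: record_slopes_def)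
  have "cf_tails (case_nat 2 ?e) (case_nat (1 / (real 2 + ?u 0)) ?u)"
    by (rule cf_tails_prepend[OF cf_tails_word]) simp
  from cf_tails_prepend_replicate[OF this, of 3 n]
  obtain t where cf: "cf_tails d t" and t: "\<And>i. t (i + n) = case_nat (1 / (real 2 + ?u 0)) ?u i"
    unfolding d_def by auto
  have d': "d (Suc n + i) = ?e i" for i by (simp add: d_def Suc_diff_le)
  have t': "t (Suc n + i) = ?u i" for i using t[of "Suc i"] by (simp add: add.commute)
  \<comment> \<open>The block of \<open>3\<close>s has value between \<open>0\<close> and
    \<open>1 / 3\<close>; with the digit \<open>2\<close> the seed becomes
    \<open>1 / (2 + l)\<close>, between \<open>3 / 7\<close> and \<open>1 / 2\<close>.\<close>
  have l: "0 \<le> cf_left d n" "cf_left d n \<le> 1 / 3"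
  proof -
    show "0 \<le> cf_left d n" by (rule cf_left_bounds[OF cf])
    show "cf_left d n \<le> 1 / 3"
    proof (cases n)
      case (Suc k)
      have "cf_left d n = 1 / (3 + cf_left d k)" by (simp add: Suc d_def)
      then show ?thesis using cf_left_bounds(1)[OF cf, of k] by simp
    qed simp
  qed
  have left: "cf_left d (Suc n) = 1 / (2 + cf_left d n)" by (simp add: d_def)
  then have left': "3 / 7 \<le> cf_left d (Suc n)" "cf_left d (Suc n) \<le> 1 / 2"
    using l by (simp_all add: field_simps)
  have "t (Suc n) \<le> 2 / 3"
    using t'[of 0] word_tail_bounds(2)[of "slope_word \<alpha>" 1] by (simp add: word_cf_tail_def)
  \<comment> \<open>At the separating digit \<open>2\<close> the constant is at most
    \<open>2 + 2 / 3 + 1 / 3\<close>.\<close>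
  then have "cf_const d t n \<le> 3" using l by (simp add: cf_const_def d_def)
  moreover have "cf_const d t i \<le> 3" if "Suc n \<le> i" for i
    by (rule cf_const_word_le_3[OF \<alpha> cf d' t' left'(2) left'(1) that])
  ultimately have le: "cf_const d t i \<le> 3" if "n \<le> i" for i
    using that by (cases "i = n") auto
  have gt: "cf_const d t i > 3" if "i < n" for i
    using that cf_tailsD(2)[OF cf, of "Suc i"] cf_left_bounds(1)[OF cf, of i]
    by (simp add: cf_const_def d_def)
  have "{i. 3 < cf_const d t i} = {..<n}"
    using le gt by (fastforce simp: not_less[symmetric])
  then have "has_exactly {i. 3 < cf_const d t i} (enat n)"
    by (simp add: has_exactly_def)
  then have "t 0 \<in> X3 (enat n)"
    by (intro cf_in_X3[OF cf] finite_cf_const_above[OF \<alpha> cf d' t' left'(2)]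
        infinite_cf_const_below[OF \<alpha> cf d' t' left'(2) inf])
  then show ?thesis using cf unfolding d_def by blast
qed

lemma X3_digits_infinite:
  assumes "\<alpha> \<in> record_slopes"
  shows "\<exists>t. cf_tails (X3_digits \<infinity> \<alpha>) t \<and> t 0 \<in> X3 \<infinity>"
proof -
  let ?e = "word_digits (slope_word \<alpha>)" and ?u = "word_cf_tail (slope_word \<alpha>)"
  have \<alpha>: "0 < \<alpha>" "\<alpha> < 1" and inf: "infinite {N. upper_record \<alpha> N}"
    using assms by (auto simp: record_slopes_def)
  note cf = cf_tails_word[of "slope_word \<alpha>"]
  have *: "?e (0 + i) = ?e i" "?u (0 + i) = ?u i" "cf_left ?e 0 \<le> 1 / 2" "cf_left ?e 0 = 0" for i
    by simp_all
  have "has_exactly {i. 3 < cf_const ?e ?u i} \<infinity>"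
    using infinite_cf_const_gt_3[OF \<alpha> cf * (1,2,3) inf * (4)] by (simp add: has_exactly_def)
  then have "?u 0 \<in> X3 \<infinity>"
    by (intro cf_in_X3[OF cf] finite_cf_const_above[OF \<alpha> cf * (1,2,3)]
        infinite_cf_const_below[OF \<alpha> cf * (1,2,3) inf])
  then show ?thesis using cf by auto
qed

section \<open>Records for uncountably many slopes\<close>

lemma frac_mult_reflect:
  assumes "\<alpha> \<notin> \<rat>" "N \<ge> 1"
  shows "frac (real N * (1 - \<alpha>)) = 1 - frac (real N * \<alpha>)"
proof -
  \<comment> \<open>At fractional part \<open>0\<close> the reflection would fail; irrationality
    excludes it.\<close>
  have "real N * \<alpha> \<notin> \<int>"
  proof
    assume "real N * \<alpha> \<in> \<int>"
    then have "real N * \<alpha> / real N \<in> \<rat>"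
      using Ints_subset_Rats by (intro Rats_divide) auto
    then show False using assms by simp
  qed
  then have "0 < frac (real N * \<alpha>)" by (simp add: frac_gt_0_iff)
  moreover have "real N * (1 - \<alpha>) - (1 - frac (real N * \<alpha>)) = of_int (int N - 1 - \<lfloor>real N * \<alpha>\<rfloor>)"
    by (simp add: frac_def algebra_simps)
  then have "real N * (1 - \<alpha>) - (1 - frac (real N * \<alpha>)) \<in> \<int>" by (metis Ints_of_int)
  ultimately show ?thesis
    using frac_lt_1[of "real N * \<alpha>"] frac_ge_0[of "real N * \<alpha>"] by (simp add: frac_unique_iff)
qed

text \<open>Here \<open>h j\<close> is the distance from \<open>j * \<alpha>\<close> to the nearest
  integer. Dirichlet's theorem makes it smaller than all of \<open>h 1, \<dots>, h c\<close>, and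
  the least index achieving this is a record beyond \<open>c\<close>.\<close>

lemma record_exists:
  fixes \<alpha> :: real
  assumes "\<alpha> \<notin> \<rat>"
  defines "h \<equiv> \<lambda>j :: nat. min (frac (real j * \<alpha>)) (1 - frac (real j * \<alpha>))"
  shows "\<exists>N>b. N \<ge> 2 \<and> (\<forall>j\<in>{1..<N}. h N < h j)"
proof -
  have pos: "h j > 0" if "j \<ge> 1" for j
  proof -
    have "frac (real j * (1 - \<alpha>)) = 1 - frac (real j * \<alpha>)" by (rule frac_mult_reflect[OF assms(1) that])
    then show ?thesis
      using frac_lt_1[of "real j * (1 - \<alpha>)"] frac_lt_1[of "real j * \<alpha>"] by (simp add: h_def)
  qed
  \<comment> \<open>The maximum with \<open>1\<close> keeps the set under \<open>Min\<close>
    nonempty and forces \<open>N \<ge> 2\<close>.\<close>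
  define c where "c = max b 1"
  define e where "e = Min (h ` {1..c})"
  have e: "e > 0" unfolding e_def using pos by (subst Min_gr_iff) (auto simp: c_def)
  have e_le: "e \<le> h j" if "j \<in> {1..c}" for j unfolding e_def using that by (intro Min_le) auto
  have ex: "\<exists>N. N \<ge> 1 \<and> h N < e"
  proof -
    obtain M :: nat where M: "M > 0" "1 / M < e"
      using e by (metis real_arch_inverse inverse_eq_divide gr0I)
    obtain p k where k: "0 < k" "\<bar>of_int k * \<alpha> - of_int p\<bar> < 1 / M"
      using Dirichlet_approx[OF M(1)] by blast
    have hk: "h (nat k) \<le> frac (of_int k * \<alpha>)" "h (nat k) \<le> 1 - frac (of_int k * \<alpha>)"
      using k(1) by (simp_all add: h_def)
    have "h (nat k) \<le> \<bar>of_int k * \<alpha> - of_int p\<bar>"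
    proof (cases "p \<le> \<lfloor>of_int k * \<alpha>\<rfloor>")
      case True
      then have "frac (of_int k * \<alpha>) \<le> of_int k * \<alpha> - of_int p" unfolding frac_def by linarith
      then show ?thesis using hk by linarith
    next
      case False
      then have "1 - frac (of_int k * \<alpha>) \<le> - (of_int k * \<alpha> - of_int p)" unfolding frac_def by linarith
      then show ?thesis using hk by linarith
    qed
    then have "nat k \<ge> 1 \<and> h (nat k) < e" using k M by auto
    then show ?thesis ..
  qed
  define N where "N = (LEAST N. N \<ge> 1 \<and> h N < e)"
  have N: "N \<ge> 1" "h N < e" using LeastI_ex[OF ex] unfolding N_def by auto
  have "h N < h j" if "j \<in> {1..<N}" for j
    using not_less_Least[of j "\<lambda>N. N \<ge> 1 \<and> h N < e"] that N(2) unfolding N_def[symmetric] by auto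
  moreover have "\<not> N \<le> c" using e_le[of N] N by auto
  ultimately show ?thesis by (intro exI[of _ N]) (auto simp: c_def)
qed

text \<open>At a record distance the nearest integer lies above or below
  \<open>N * \<alpha>\<close>. Above gives an upper record of \<open>\<alpha>\<close>; below gives
  one of \<open>1 - \<alpha>\<close>, by reflection.\<close>

lemma upper_record_infinite:
  assumes "\<alpha> \<notin> \<rat>"
  shows "infinite {N. upper_record \<alpha> N} \<or> infinite {N. upper_record (1 - \<alpha>) N}"
proof -
  define h where "h = (\<lambda>j :: nat. min (frac (real j * \<alpha>)) (1 - frac (real j * \<alpha>)))"
  have "infinite {N. N \<ge> 2 \<and> (\<forall>j\<in>{1..<N}. h N < h j)}"
    using record_exists[OF assms] unfolding h_def infinite_nat_iff_unbounded by simp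
  moreover have "{N. N \<ge> 2 \<and> (\<forall>j\<in>{1..<N}. h N < h j)} \<subseteq> {N. upper_record \<alpha> N} \<union> {N. upper_record (1 - \<alpha>) N}"
  proof
    fix N assume "N \<in> {N. N \<ge> 2 \<and> (\<forall>j\<in>{1..<N}. h N < h j)}"
    then have N: "N \<ge> 2" and rec: "\<And>j. j \<in> {1..<N} \<Longrightarrow> h N < h j" by auto
    show "N \<in> {N. upper_record \<alpha> N} \<union> {N. upper_record (1 - \<alpha>) N}"
    proof (cases "frac (real N * \<alpha>) \<le> 1 / 2")
      case True
      have "1 - frac (real N * (1 - \<alpha>)) < frac (real j * (1 - \<alpha>)) \<and>
          frac (real j * (1 - \<alpha>)) < frac (real N * (1 - \<alpha>))" if "j \<in> {1..<N}" for j
        using rec[OF that] True that N frac_mult_reflect[OF assms, of N] frac_mult_reflect[OF assms, of j]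
        by (auto simp: h_def)
      then have "upper_record (1 - \<alpha>) N" using N unfolding upper_record_def by blast
      then show ?thesis by blast
    next
      case False
      have "1 - frac (real N * \<alpha>) < frac (real j * \<alpha>) \<and> frac (real j * \<alpha>) < frac (real N * \<alpha>)"
        if "j \<in> {1..<N}" for j
        using rec[OF that] False by (auto simp: h_def)
      then have "upper_record \<alpha> N" using N unfolding upper_record_def by blast
      then show ?thesis by blast
    qed
  qed
  ultimately show ?thesis using infinite_super finite_UnI by blast
qed

text \<open>Together with its reflection the set covers the irrationals of the unit
  interval.\<close>

lemma uncountable_record_slopes: "uncountable record_slopes"
proof
  assume c: "countable record_slopes"
  have "{0<..<1} - \<rat> \<subseteq> record_slopes \<union> (\<lambda>\<alpha>. 1 - \<alpha>) ` record_slopes"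
  proof
    fix \<alpha> :: real assume \<alpha>: "\<alpha> \<in> {0<..<1} - \<rat>"
    from upper_record_infinite[of \<alpha>] show "\<alpha> \<in> record_slopes \<union> (\<lambda>\<alpha>. 1 - \<alpha>) ` record_slopes"
    proof
      assume "infinite {N. upper_record \<alpha> N}"
      then show ?thesis using \<alpha> by (simp add: record_slopes_def)
    next
      assume "infinite {N. upper_record (1 - \<alpha>) N}"
      then have "1 - \<alpha> \<in> record_slopes" using \<alpha> by (simp add: record_slopes_def)
      then have "1 - (1 - \<alpha>) \<in> (\<lambda>\<alpha>. 1 - \<alpha>) ` record_slopes" by (rule imageI)
      then show ?thesis by simp
    qed (use \<alpha> in simp)
  qed
  moreover have "uncountable ({0<..<1 :: real} - \<rat>)"
    by (rule uncountable_minus_countable) (simp_all add: uncountable_open_interval countable_rat)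
  moreover have "countable (record_slopes \<union> (\<lambda>\<alpha>. 1 - \<alpha>) ` record_slopes)" using c by simp
  ultimately show False using countable_subset by metis
qed

theorem theorem1p1:
  fixes n :: enat
  shows "uncountable (X3 n)"
proof
  assume c: "countable (X3 n)"
  have "\<forall>\<alpha>\<in>record_slopes. \<exists>t. cf_tails (X3_digits n \<alpha>) t \<and> t 0 \<in> X3 n"
    using X3_digits_finite X3_digits_infinite by (cases n) auto
  from bchoice[OF this] obtain t
    where t: "\<And>\<alpha>. \<alpha> \<in> record_slopes \<Longrightarrow> cf_tails (X3_digits n \<alpha>) (t \<alpha>) \<and> t \<alpha> 0 \<in> X3 n"
    by blast
  \<comment> \<open>The number determines its partial quotients, and these determine the
    slope.\<close>
  have "inj_on (\<lambda>\<alpha>. t \<alpha> 0) record_slopes"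
  proof (rule inj_onI)
    fix \<alpha> \<beta> assume *: "\<alpha> \<in> record_slopes" "\<beta> \<in> record_slopes" "t \<alpha> 0 = t \<beta> 0"
    from cf_tails_unique[OF conjunct1[OF t[OF *(1)]] conjunct1[OF t[OF *(2)]] *(3)]
    show "\<alpha> = \<beta>" using X3_digits_inj *(1,2) by blast
  qed
  moreover have "(\<lambda>\<alpha>. t \<alpha> 0) ` record_slopes \<subseteq> X3 n" using t by blast
  ultimately have "countable record_slopes"
    using c countable_subset countable_image_inj_on by metis
  then show False using uncountable_record_slopes by blast
qed

end
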